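(* There exist absolute constants $A, B > 0$ such that the following holds. Let $G = \mathbb{F}_2^n$ for some $n$, let $r$ be a positive integer, and suppose that $\alpha \colon G^5 \to \mathbb{F}_2$ is a multilinear form such that: (1) $\alpha$ is symmetric in the first 3 variables; (2) $\operatorname{prank}(\alpha + \alpha\circ(3\,\,4)) \leq r$. Then there exists a multilinear form $\alpha' \colon G^5 \to \mathbb{F}_2$ which is symmetric in the first 4 variables and satisfies $\operatorname{prank}(\alpha + \alpha') \leq \exp(\exp(A r^{B}))$.
   Context: For a multilinear form $\alpha \colon G^5 \to \mathbb{F}_2$, $\alpha\circ(3\,\,4)$ is the form $(x_1,\dots,x_5)\mapsto\alpha(x_1,x_2,x_4,x_3,x_5)$. A form is symmetric in a set of variables if it is invariant under all permutations of those variables. The partition rank $\operatorname{prank}\alpha$ of a multilinear form $\alpha \colon G^k \to \mathbb{F}_2$ is the least non-negative integer $m$ such that \[\alpha(x_1,\dots,x_k) = \sum_{i=1}^m \beta_i(x_j : j \in I_i)\,\gamma_i(x_j : j \in [k]\setminus I_i)\] for some sets $\emptyset \neq I_i \subsetneq [k]$ and multilinear forms $\beta_i \colon G^{I_i} \to \mathbb{F}_2$, $\gamma_i \colon G^{[k]\setminus I_i} \to \mathbb{F}_2$. *)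

theory Defs
  imports
    Complex_Main
    "HOL-Library.Z2"
    "HOL-Library.FuncSet"
    "HOL-Combinatorics.Permutations"
    "Jordan_Normal_Form.Matrix"
begin

text \<open>
  The field with two elements is the type \<^typ>\<open>bit\<close>, and the group \<open>G\<close> of vectors of length \<open>n\<close>
  over it is \<^term>\<open>carrier_vec n :: bit vec set\<close>.  A point of \<open>G\<close> to the power \<open>I\<close>, for a set \<open>I\<close>
  of indices, is an extensional function on \<open>I\<close>.  A form on that set is a function whose values
  at all other arguments are never looked at.
\<close>

definition tuples :: "nat \<Rightarrow> nat set \<Rightarrow> (nat \<Rightarrow> bit vec) set" where
  "tuples n I = (\<Pi>\<^sub>E j\<in>I. carrier_vec n)"

definition multilinear_form :: "nat \<Rightarrow> nat set \<Rightarrow> ((nat \<Rightarrow> bit vec) \<Rightarrow> bit) \<Rightarrow> bool" where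
  "multilinear_form n I \<alpha> \<longleftrightarrow>
     (\<forall>x\<in>tuples n I. \<forall>j\<in>I. \<forall>u\<in>carrier_vec n. \<forall>v\<in>carrier_vec n. \<forall>c.
        \<alpha> (x(j := u + v)) = \<alpha> (x(j := u)) + \<alpha> (x(j := v)) \<and>
        \<alpha> (x(j := c \<cdot>\<^sub>v u)) = c * \<alpha> (x(j := u)))"

text \<open>
  The form sending \<open>(x\<^sub>1, \<dots>, x\<^sub>k)\<close> to \<open>\<alpha> (x\<^bsub>\<pi> 1\<^esub>, \<dots>, x\<^bsub>\<pi> k\<^esub>)\<close>.
\<close>

definition permute_form ::
    "((nat \<Rightarrow> bit vec) \<Rightarrow> bit) \<Rightarrow> (nat \<Rightarrow> nat) \<Rightarrow> (nat \<Rightarrow> bit vec) \<Rightarrow> bit" where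
  "permute_form \<alpha> \<pi> = (\<lambda>x. \<alpha> (x \<circ> \<pi>))"

definition symmetric_in :: "nat \<Rightarrow> nat \<Rightarrow> nat set \<Rightarrow> ((nat \<Rightarrow> bit vec) \<Rightarrow> bit) \<Rightarrow> bool" where
  "symmetric_in n k S \<alpha> \<longleftrightarrow>
     (\<forall>\<pi>. \<pi> permutes S \<longrightarrow> (\<forall>x\<in>tuples n {1..k}. permute_form \<alpha> \<pi> x = \<alpha> x))"

definition partition_decomposable ::
    "nat \<Rightarrow> nat \<Rightarrow> ((nat \<Rightarrow> bit vec) \<Rightarrow> bit) \<Rightarrow> nat \<Rightarrow> bool" where
  "partition_decomposable n k \<alpha> m \<longleftrightarrow>
     (\<exists>I \<beta> \<gamma>.
        (\<forall>i\<in>{1..m}. I i \<noteq> {} \<and> I i \<subset> {1..k} \<and>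
           multilinear_form n (I i) (\<beta> i) \<and>
           multilinear_form n ({1..k} - I i) (\<gamma> i)) \<and>
        (\<forall>x\<in>tuples n {1..k}.
           \<alpha> x = (\<Sum>i = 1..m. \<beta> i (restrict x (I i)) * \<gamma> i (restrict x ({1..k} - I i)))))"

text \<open>
  For \<open>k \<ge> 2\<close> every multilinear form has a decomposition (expand the first variable in the
  standard basis), so the least element exists.
\<close>

definition prank :: "nat \<Rightarrow> nat \<Rightarrow> ((nat \<Rightarrow> bit vec) \<Rightarrow> bit) \<Rightarrow> nat" where
  "prank n k \<alpha> = (LEAST m. partition_decomposable n k \<alpha> m)"

end

(*
  Every finite space V of bilinear forms has a basis h_j dual to points q_j = (u_j, v_j),
  so the V-component of a form f in a pair of coordinates (a, b) can be read off by substituting the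
  q_j there, and  sum_j h_j(x_a, x_b) f(x with u_j, v_j at a, b)  is a low-rank form carrying that
  component.  After a projection the defect  f + f o (3 4)  is a short sum of products of a bilinear
  form (from some V closed under transposition) and a trilinear one.  Adding to f all its
  V-components keeps the symmetry in the first three variables, provided that for the pairs inside
  {1, 2, 3} one interpolates with symmetric members of V only.  The corrected form is killed by
  substituting any q_j in any pair of coordinates, up to terms that contain a linear factor in a
  single variable; here the number 5 matters, since after removing two pairs of coordinates only one
  is left.  Hence the V-components of the new defect have only such terms too, and the new defect
  vanishes once these boundedly many linear forms are zero.  Composing with a projection onto their
  common kernel changes the form by bounded rank and makes it exactly symmetric.
*)
theory Submission
  imports Defs "HOL-Library.Function_Algebras"
begin

text \<open>In characteristic two one cannot average over permutations, so symmetry has to come from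
  cancellation. The obstacle is that two interpolations must fit together: pairs inside {1, 2, 3}
  are treated with the symmetric members of V and points p_i dual to those, all other pairs with V
  and its points q_j, while the new defect has to vanish at the q_j in every pair. The link is the
  set X of the p_i and their reversals. A member of V that vanishes on X is zero, so the q_j can be
  chosen inside X; and a form symmetric in two coordinates takes the same value at p_i and at its
  reversal, so the smaller interpolation is exact on all of X.

  Both exponentials are the price of counting: V has up to 4^r members, hence on the order of 16^r
  linear forms have to vanish, and a projection annihilating N of them is charged up to 5 * 2^N
  products.\<close>

declare add_bit_eq_xor [simp del] mult_bit_eq_and [simp del]

lemma bit_add_self [simp]: "a + a = (0::bit)"
  by (cases a) simp_all

lemma bit_add_left_self [simp]: "a + (a + b) = (b::bit)"
  by (simp flip: add.assoc)

subsection \<open>Finite spaces of Boolean functions\<close>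

text \<open>A dual family that cannot be extended works. If some f in V is not reproduced, its
  remainder is a nonzero member of V that vanishes at all \<open>p i\<close>, and a point of X where
  it equals 1 extends the family. Members of a dual family are distinct, so this stops by
  \<open>card V\<close>. The points are confined to X because later they have to lie in a prescribed
  set.\<close>

lemma interpolation:
  fixes V :: "('b \<Rightarrow> bit) set"
  assumes fin: "finite V" and zero: "(\<lambda>_. 0) \<in> V"
    and add: "\<And>f g. f \<in> V \<Longrightarrow> g \<in> V \<Longrightarrow> (\<lambda>x. f x + g x) \<in> V"
    and sep: "\<And>f. f \<in> V \<Longrightarrow> (\<And>x. x \<in> X \<Longrightarrow> f x = 0) \<Longrightarrow> f = (\<lambda>_. 0)"
  obtains k g p where "k \<le> card V" "\<And>i. i < k \<Longrightarrow> g i \<in> V" "\<And>i. i < k \<Longrightarrow> p i \<in> X"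
    "\<And>i j. i < k \<Longrightarrow> j < k \<Longrightarrow> g i (p j) = of_bool (i = j)"
    "\<And>f x. f \<in> V \<Longrightarrow> f x = (\<Sum>i<k. f (p i) * g i x)"
proof -
  define D where "D k g p \<longleftrightarrow> (\<forall>i<k. g i \<in> V \<and> p i \<in> X) \<and>
      (\<forall>i<k. \<forall>j<k. g i (p j) = of_bool (i = j))" for k :: nat and g :: "nat \<Rightarrow> 'b \<Rightarrow> bit" and p
  have comb: "(\<lambda>x. \<Sum>i<k. c i * g i x) \<in> V" if "\<forall>i<k. g i \<in> V"
    for k :: nat and c and g :: "nat \<Rightarrow> 'b \<Rightarrow> bit"
    using that
  proof (induction k)
    case 0
    then show ?case using zero by simp
  next
    case (Suc k)
    have "(\<lambda>x. c k * g k x) \<in> V"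
      using Suc.prems zero by (cases "c k") auto
    with Suc add[of "\<lambda>x. \<Sum>i<k. c i * g i x" "\<lambda>x. c k * g k x"] show ?case by simp
  qed
  have bound: "k \<le> card V" if "D k g p" for k g p
  proof -
    have "inj_on g {..<k}"
    proof (rule inj_onI)
      fix i j assume ij: "i \<in> {..<k}" "j \<in> {..<k}" "g i = g j"
      have "g j (p j) = 1" using that ij(2) by (simp add: D_def)
      moreover have "g i (p j) = of_bool (i = j)" using that ij(1,2) unfolding D_def by blast
      ultimately show "i = j" using ij(3) by (cases "i = j") auto
    qed
    moreover have "g ` {..<k} \<subseteq> V" using that by (auto simp: D_def)
    ultimately show ?thesis using card_inj_on_le[OF _ _ fin] by fastforce
  qed
  have step: "\<exists>g p. D (Suc k) g p"
    if D: "D k g p" and f: "f \<in> V" and neq: "f y \<noteq> (\<Sum>i<k. f (p i) * g i y)" for k g p f y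
  proof -
    define h where "h = (\<lambda>x. f x + (\<Sum>i<k. f (p i) * g i x))"
    have hV: "h \<in> V"
      unfolding h_def using D f by (intro add comb) (auto simp: D_def)
    have hp: "h (p j) = 0" if "j < k" for j
    proof -
      have "(\<Sum>i<k. f (p i) * g i (p j)) = (\<Sum>i<k. if i = j then f (p i) else 0)"
        using D that by (intro sum.cong) (auto simp: D_def)
      then show ?thesis using that by (simp add: h_def)
    qed
    have "h y \<noteq> 0"
    proof
      assume "h y = 0"
      then have "f y + h y = f y" by simp
      with neq show False by (simp add: h_def)
    qed
    then obtain q where q: "q \<in> X" "h q = 1" using sep[OF hV] by fastforce
    \<comment> \<open>Adding \<open>g i q * h\<close> clears the value of \<open>g i\<close> at the
      new point q; the old values stay, since h vanishes at the old points.\<close>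
    define g' where "g' i = (if i < k then (\<lambda>x. g i x + g i q * h x) else h)" for i
    have mult: "(\<lambda>x. c * h x) \<in> V" for c using hV zero by (cases c) auto
    have "g' i \<in> V" if "i < Suc k" for i
      using that D hV add[OF _ mult, of "g i" "g i q"] by (auto simp: g'_def D_def)
    moreover have "(p(k := q)) i \<in> X" if "i < Suc k" for i
      using that D q by (auto simp: D_def)
    moreover have "g' i ((p(k := q)) j) = of_bool (i = j)" if ij: "i < Suc k" "j < Suc k" for i j
    proof -
      consider "i < k" "j < k" | "i < k" "j = k" | "i = k" "j < k" | "i = k" "j = k"
        using ij unfolding less_Suc_eq by blast
      then show ?thesis using D hp q by cases (simp_all add: D_def g'_def)
    qed
    ultimately have "D (Suc k) g' (p(k := q))" by (simp add: D_def)
    then show ?thesis by blast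
  qed
  have "\<exists>k g p. D k g p \<and> (\<forall>f\<in>V. \<forall>x. f x = (\<Sum>i<k. f (p i) * g i x))"
  proof (rule ccontr)
    assume no: "\<not> ?thesis"
    have "\<exists>g p. D k g p" for k
    proof (induction k)
      case 0
      then show ?case by (simp add: D_def)
    next
      case (Suc k)
      then show ?case using no step by blast
    qed
    then show False using bound by (metis not_less_eq_eq order_refl)
  qed
  then obtain k g p where D: "D k g p" and ex: "\<forall>f\<in>V. \<forall>x. f x = (\<Sum>i<k. f (p i) * g i x)"
    by blast
  show ?thesis
    by (rule that[of k g p]) (use D ex bound[OF D] in \<open>simp_all add: D_def\<close>)
qed

text \<open>Over the field with two elements, subset sums are all the linear combinations.\<close>

definition bit_span :: "('b \<Rightarrow> bit) set \<Rightarrow> ('b \<Rightarrow> bit) set" where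
  "bit_span S = (\<lambda>A x. \<Sum>b\<in>A. b x) ` Pow S"

lemma finite_bit_span: "finite S \<Longrightarrow> finite (bit_span S)"
  by (simp add: bit_span_def)

lemma card_bit_span: "finite S \<Longrightarrow> card (bit_span S) \<le> 2 ^ card S"
  unfolding bit_span_def using card_image_le[of "Pow S"] by (simp add: card_Pow)

lemma zero_in_bit_span: "(\<lambda>_. 0) \<in> bit_span S"
  unfolding bit_span_def by (rule image_eqI[of _ _ "{}"]) auto

lemma base_in_bit_span: "b \<in> S \<Longrightarrow> b \<in> bit_span S"
  unfolding bit_span_def by (rule image_eqI[of _ _ "{b}"]) auto

text \<open>Common summands cancel in characteristic two, which leaves the sum over the symmetric
  difference.\<close>

lemma add_in_bit_span:
  assumes "finite S" "f \<in> bit_span S" "g \<in> bit_span S"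
  shows "(\<lambda>x. f x + g x) \<in> bit_span S"
proof -
  obtain A B where AB: "A \<subseteq> S" "B \<subseteq> S" "f = (\<lambda>x. \<Sum>b\<in>A. b x)" "g = (\<lambda>x. \<Sum>b\<in>B. b x)"
    using assms by (auto simp: bit_span_def)
  then have fin: "finite A" "finite B" using assms(1) finite_subset by auto
  have "f x + g x = (\<Sum>b\<in>(A - B) \<union> (B - A). b x)" for x
  proof -
    have "f x = (\<Sum>b\<in>A \<inter> B. b x) + (\<Sum>b\<in>A - B. b x)"
      using fin by (simp add: AB sum.Int_Diff[of A _ B])
    moreover have "g x = (\<Sum>b\<in>A \<inter> B. b x) + (\<Sum>b\<in>B - A. b x)"
      using fin by (simp add: AB sum.Int_Diff[of B _ A] Int_commute)
    moreover have "(\<Sum>b\<in>(A - B) \<union> (B - A). b x) = (\<Sum>b\<in>A - B. b x) + (\<Sum>b\<in>B - A. b x)"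
      using fin by (intro sum.union_disjoint) auto
    ultimately show ?thesis by (simp add: ac_simps)
  qed
  then show ?thesis
    unfolding bit_span_def using AB by (intro image_eqI[of _ _ "(A - B) \<union> (B - A)"]) auto
qed

lemma bit_span_induct [consumes 2, case_names zero base add]:
  assumes "finite S" "f \<in> bit_span S"
    and "P (\<lambda>_. 0)" "\<And>b. b \<in> S \<Longrightarrow> P b" "\<And>f g. P f \<Longrightarrow> P g \<Longrightarrow> P (\<lambda>x. f x + g x)"
  shows "P f"
proof -
  obtain A where A: "A \<subseteq> S" "f = (\<lambda>x. \<Sum>b\<in>A. b x)" using assms(2) by (auto simp: bit_span_def)
  have "finite A" using A assms(1) finite_subset by auto
  then have "P (\<lambda>x. \<Sum>b\<in>A. b x)"
    using A(1)
  proof (induction A rule: finite_induct)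
    case empty
    then show ?case using assms(3) by simp
  next
    case (insert b A)
    then show ?case using assms(4)[of b] assms(5)[of b "\<lambda>x. \<Sum>b\<in>A. b x"] by simp
  qed
  then show ?thesis using A by simp
qed

subsection \<open>Multilinear forms on a group\<close>

text \<open>With 0 and 1 as the only scalars additivity is linearity, so an abelian group suffices
  as the domain.\<close>

definition additive_form :: "('a::ab_group_add \<Rightarrow> bit) \<Rightarrow> bool" where
  "additive_form l \<longleftrightarrow> (\<forall>u v. l (u + v) = l u + l v)"

text \<open>Taken on pairs, so that a bilinear form is a function of one point and
  \<open>interpolation\<close> applies to spaces of such forms.\<close>

definition biadditive :: "('a::ab_group_add \<times> 'a \<Rightarrow> bit) \<Rightarrow> bool" where
  "biadditive \<beta> \<longleftrightarrow> (\<forall>w. additive_form (\<lambda>u. \<beta> (u, w)) \<and> additive_form (\<lambda>u. \<beta> (w, u)))"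

text \<open>The index set enters as a condition on dependence and not as a domain: forms in
  different sets of variables then share one type and can be multiplied, substituted into and
  permuted freely.\<close>

definition multi :: "nat set \<Rightarrow> ((nat \<Rightarrow> 'a::ab_group_add) \<Rightarrow> bit) \<Rightarrow> bool" where
  "multi I f \<longleftrightarrow> (\<forall>x y. (\<forall>j\<in>I. x j = y j) \<longrightarrow> f x = f y) \<and>
     (\<forall>x. \<forall>j\<in>I. additive_form (\<lambda>u. f (x(j := u))))"

lemma additive_form_add: "additive_form l \<Longrightarrow> l (u + v) = l u + l v"
  by (simp add: additive_form_def)

lemma additive_form_zero: "additive_form l \<Longrightarrow> l 0 = 0"
  using additive_form_add[of l 0 0] by simp

lemma additive_form_sum:
  assumes "additive_form l"
  shows "l (\<Sum>i\<in>A. e i) = (\<Sum>i\<in>A. l (e i))"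
  by (induction A rule: infinite_finite_induct)
    (auto simp: additive_form_zero[OF assms] additive_form_add[OF assms])

lemma multi_cong: "multi I f \<Longrightarrow> (\<And>j. j \<in> I \<Longrightarrow> x j = y j) \<Longrightarrow> f x = f y"
  unfolding multi_def by blast

lemma multi_additive: "multi I f \<Longrightarrow> j \<in> I \<Longrightarrow> additive_form (\<lambda>u. f (x(j := u)))"
  unfolding multi_def by blast

lemma multi_coord_zero: "multi I f \<Longrightarrow> j \<in> I \<Longrightarrow> x j = 0 \<Longrightarrow> f x = 0"
  using additive_form_zero[OF multi_additive[of I f j x]] fun_upd_triv[of x j] by simp

lemma multi_zero: "multi I (\<lambda>_. 0)"
  by (simp add: multi_def additive_form_def)

lemma multi_add:
  assumes f: "multi I f" and g: "multi I g"
  shows "multi I (\<lambda>x. f x + g x)"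
  unfolding multi_def
proof (intro conjI allI impI ballI)
  fix x y :: "nat \<Rightarrow> 'a" assume "\<forall>j\<in>I. x j = y j"
  then show "f x + g x = f y + g y" using multi_cong[OF f, of x y] multi_cong[OF g, of x y] by simp
next
  fix x :: "nat \<Rightarrow> 'a" and j assume "j \<in> I"
  from multi_additive[OF f this, of x] multi_additive[OF g this, of x]
  show "additive_form (\<lambda>u. f (x(j := u)) + g (x(j := u)))"
    by (simp add: additive_form_def)
qed

lemma multi_sum: "(\<And>i. i \<in> A \<Longrightarrow> multi I (f i)) \<Longrightarrow> multi I (\<lambda>x. \<Sum>i\<in>A. f i x)"
  by (induction A rule: infinite_finite_induct) (auto intro: multi_zero multi_add)

lemma multi_mult:
  assumes f: "multi J f" and g: "multi K g" and disj: "J \<inter> K = {}"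
  shows "multi (J \<union> K) (\<lambda>x. f x * g x)"
  unfolding multi_def
proof (intro conjI allI impI ballI)
  fix x y :: "nat \<Rightarrow> 'a" assume "\<forall>j\<in>J \<union> K. x j = y j"
  then have "f x = f y" "g x = g y" using multi_cong[OF f, of x y] multi_cong[OF g, of x y] by auto
  then show "f x * g x = f y * g y" by simp
next
  fix x :: "nat \<Rightarrow> 'a" and j assume "j \<in> J \<union> K"
  then consider "j \<in> J" "j \<notin> K" | "j \<in> K" "j \<notin> J" using disj by blast
  then show "additive_form (\<lambda>u. f (x(j := u)) * g (x(j := u)))"
  proof cases
    case 1
    have "g (x(j := u)) = g x" for u using 1 by (intro multi_cong[OF g]) auto
    then show ?thesis
      using multi_additive[OF f, of j x] 1 by (simp add: additive_form_def distrib_right)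
  next
    case 2
    have "f (x(j := u)) = f x" for u using 2 by (intro multi_cong[OF f]) auto
    then show ?thesis
      using multi_additive[OF g, of j x] 2 by (simp add: additive_form_def distrib_left)
  qed
qed

lemma multi_fix:
  assumes "multi I f"
  shows "multi (I - {a}) (\<lambda>x. f (x(a := u)))"
  unfolding multi_def
proof (intro conjI allI impI ballI)
  fix x y :: "nat \<Rightarrow> 'a" assume "\<forall>j\<in>I - {a}. x j = y j"
  then show "f (x(a := u)) = f (y(a := u))" by (intro multi_cong[OF assms]) auto
next
  fix x :: "nat \<Rightarrow> 'a" and j assume "j \<in> I - {a}"
  then show "additive_form (\<lambda>v. f (x(j := v, a := u)))"
    using multi_additive[OF assms, of j "x(a := u)"] fun_upd_twist[of j a x _ u] by auto
qed

lemma multi_fix2: "multi I f \<Longrightarrow> multi (I - {a, b}) (\<lambda>x. f (x(a := u, b := v)))"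
  using multi_fix[OF multi_fix[of I f b v], of a u] Diff_insert[of I a "{b}"] by simp

lemma multi_biadditive:
  assumes "biadditive \<beta>" "a \<noteq> b"
  shows "multi {a, b} (\<lambda>x. \<beta> (x a, x b))"
  using assms unfolding multi_def biadditive_def by auto

lemma multi_single: "additive_form l \<Longrightarrow> multi {a} (\<lambda>x. l (x a))"
  by (simp add: multi_def)

lemma fun_upd_comp_transpose:
  "(x(a := u)) \<circ> transpose c d = (x \<circ> transpose c d)(transpose c d a := u)"
  by (auto simp: fun_eq_iff transpose_def)

lemma multi_transpose:
  assumes "multi I f"
  shows "multi (transpose a b ` I) (\<lambda>x. f (x \<circ> transpose a b))"
  unfolding multi_def
proof (intro conjI allI impI ballI)
  fix x y :: "nat \<Rightarrow> 'a" assume "\<forall>j\<in>transpose a b ` I. x j = y j"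
  then show "f (x \<circ> transpose a b) = f (y \<circ> transpose a b)" by (intro multi_cong[OF assms]) auto
next
  fix x :: "nat \<Rightarrow> 'a" and j assume "j \<in> transpose a b ` I"
  then show "additive_form (\<lambda>u. f (x(j := u) \<circ> transpose a b))"
    using multi_additive[OF assms, of "transpose a b j" "x \<circ> transpose a b"]
    by (auto simp: fun_upd_comp_transpose)
qed

text \<open>The map may vary with the coordinate because projections are applied to an initial
  segment of the coordinates when their effect is telescoped.\<close>

lemma multi_map:
  assumes "multi I f" and add: "\<And>j u v. q j (u + v) = q j u + q j v"
  shows "multi I (\<lambda>x. f (\<lambda>j. q j (x j)))"
  unfolding multi_def
proof (intro conjI allI impI ballI)
  fix x y :: "nat \<Rightarrow> 'b" assume "\<forall>j\<in>I. x j = y j"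
  then show "f (\<lambda>j. q j (x j)) = f (\<lambda>j. q j (y j))" by (intro multi_cong[OF assms(1)]) auto
next
  fix x :: "nat \<Rightarrow> 'b" and j assume j: "j \<in> I"
  have "(\<lambda>i. q i ((x(j := u)) i)) = (\<lambda>i. q i (x i))(j := q j u)" for u by auto
  then show "additive_form (\<lambda>u. f (\<lambda>i. q i ((x(j := u)) i)))"
    using multi_additive[OF assms(1) j, of "\<lambda>i. q i (x i)"] by (simp add: additive_form_def add)
qed

subsection \<open>Decompositions into products\<close>

text \<open>An upper bound m for the partition rank, generated one product at a time so that
  decompositions add without reindexing.\<close>

inductive product_sum :: "nat \<Rightarrow> ((nat \<Rightarrow> 'a::ab_group_add) \<Rightarrow> bit) \<Rightarrow> bool" where
  zero: "product_sum 0 (\<lambda>_. 0)"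
| step: "product_sum m F \<Longrightarrow> J \<noteq> {} \<Longrightarrow> J \<subset> {1..5} \<Longrightarrow> multi J \<beta> \<Longrightarrow> multi ({1..5} - J) \<gamma> \<Longrightarrow>
    product_sum (Suc m) (\<lambda>x. F x + \<beta> x * \<gamma> x)"

lemma product_sum_single:
  assumes "J \<noteq> {}" "J \<subset> {1..5}" "multi J \<beta>" "multi ({1..5} - J) \<gamma>"
  shows "product_sum 1 (\<lambda>x. \<beta> x * \<gamma> x)"
  using product_sum.step[OF product_sum.zero assms] by simp

lemma product_sum_add:
  assumes "product_sum m F" "product_sum l G"
  shows "product_sum (m + l) (\<lambda>x. F x + G x)"
  using assms(2)
proof induction
  case zero
  then show ?case using assms(1) by simp
next
  case (step l G J \<beta> \<gamma>)
  then show ?case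
    using product_sum.step[OF step.IH, of J \<beta> \<gamma>] by (simp add: add.assoc)
qed

lemma product_sum_sum:
  assumes "finite A" "\<And>i. i \<in> A \<Longrightarrow> product_sum m (G i)"
  shows "product_sum (card A * m) (\<lambda>x. \<Sum>i\<in>A. G i x)"
  using assms
  by (induction A rule: finite_induct) (auto intro: product_sum.zero product_sum_add)

text \<open>
  The projection moves every point by a combination of at most \<open>k\<close> fixed vectors, so that
  composing with it changes a form in each coordinate by at most \<open>k\<close> products.
\<close>

lemma annihilating_projection:
  fixes L :: "('a::ab_group_add \<Rightarrow> bit) set"
  assumes char2: "\<And>e::'a. e + e = 0" and fin: "finite L" and L: "\<And>l. l \<in> L \<Longrightarrow> additive_form l"
  obtains k p where "k \<le> 2 ^ card L" "\<And>u v. p (u + v) = p u + p v" "\<And>l u. l \<in> L \<Longrightarrow> l (p u) = 0"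
    "\<And>F. multi {1..5} F \<Longrightarrow> product_sum (5 * k) (\<lambda>x. F x + F (\<lambda>j. p (x j)))"
proof -
  obtain k g e where k: "k \<le> card (bit_span L)" and g: "\<And>i. i < k \<Longrightarrow> g i \<in> bit_span L"
    and expand: "\<And>f x. f \<in> bit_span L \<Longrightarrow> f x = (\<Sum>i<k. f (e i) * g i x)"
    by (rule interpolation[OF finite_bit_span[OF fin] zero_in_bit_span add_in_bit_span[OF fin],
          of UNIV]) auto
  have gadd: "additive_form (g i)" if "i < k" for i
    using fin g[OF that]
  proof (induction rule: bit_span_induct)
    case zero
    then show ?case by (simp add: additive_form_def)
  next
    case (base b)
    then show ?case by (rule L)
  next
    case (add f g)
    then show ?case by (simp add: additive_form_def ac_simps)
  qed
  \<comment> \<open>This removes from u its components along the vectors \<open>e i\<close>; in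
    characteristic two removing is adding, and the scalar \<open>g i u\<close> appears as a case
    distinction since the group has no scalar multiplication. For l in L the expansion of l turns
    \<open>l (p u)\<close> into \<open>l u + l u\<close>.\<close>
  define p where "p u = u + (\<Sum>i<k. if g i u = 1 then e i else 0)" for u
  have scal: "(if a + b = 1 then w else 0) = (if a = 1 then w else 0) + (if b = 1 then w else 0)"
    for a b :: bit and w :: 'a
    by (cases a; cases b) (auto simp: char2)
  have padd: "p (u + v) = p u + p v" for u v
  proof -
    have "(\<Sum>i<k. if g i (u + v) = 1 then e i else 0) =
      (\<Sum>i<k. (if g i u = 1 then e i else 0) + (if g i v = 1 then e i else 0))"
      by (intro sum.cong) (auto simp only: additive_form_add[OF gadd] scal lessThan_iff)
    then show ?thesis by (simp add: p_def sum.distrib ac_simps)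
  qed
  have along: "\<phi> (p u) = \<phi> u + (\<Sum>i<k. \<phi> (e i) * g i u)" if "additive_form \<phi>" for \<phi> u
  proof -
    have "\<phi> (if g i u = 1 then e i else 0) = \<phi> (e i) * g i u" for i
      using additive_form_zero[OF that] by (cases "g i u") auto
    then show ?thesis
      by (simp add: p_def additive_form_add[OF that] additive_form_sum[OF that])
  qed
  have kill: "l (p u) = 0" if "l \<in> L" for l u
    using along[OF L[OF that], of u] expand[OF base_in_bit_span[OF that], of u] by simp
  have one: "product_sum k (\<lambda>x. F x + F (x(a := p (x a))))" if F: "multi {1..5} F" and a: "a \<in> {1..5}" for F a
  proof -
    have "(if a = 1 then 2 else 1) \<in> {1..5} - {a}" by auto
    then have sub: "{a} \<subset> {1..5}" using a by blast
    have "product_sum 1 (\<lambda>x. g i (x a) * F (x(a := e i)))" if "i < k" for i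
      using sub by (intro product_sum_single[of "{a}"] multi_single gadd that multi_fix F) auto
    then have "product_sum k (\<lambda>x. \<Sum>i<k. g i (x a) * F (x(a := e i)))"
      using product_sum_sum[of "{..<k}" 1 "\<lambda>i x. g i (x a) * F (x(a := e i))"] by simp
    moreover have "F (x(a := p (x a))) = F x + (\<Sum>i<k. g i (x a) * F (x(a := e i)))" for x
      using along[OF multi_additive[OF F a, of x], of "x a"] by (simp add: mult.commute)
    ultimately show ?thesis by simp
  qed
  \<comment> \<open>Telescoping: the coordinates up to m are already projected, and each further one
    costs k products by \<open>one\<close>.\<close>
  have "product_sum (m * k) (\<lambda>x. F x + F (\<lambda>j. if j \<in> {1..m} then p (x j) else x j))"
    if F: "multi {1..5} F" and "m \<le> 5" for F m
    using that(2)
  proof (induction m)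
    case 0
    then show ?case by (simp add: product_sum.zero)
  next
    case (Suc m)
    define G where "G x = F (\<lambda>j. if j \<in> {1..m} then p (x j) else x j)" for x
    have "multi {1..5} G"
      unfolding G_def using multi_map[OF F, of "\<lambda>j u. if j \<in> {1..m} then p u else u"] by (simp add: padd)
    then have "product_sum k (\<lambda>x. G x + G (x(Suc m := p (x (Suc m)))))"
      using one Suc.prems by simp
    moreover have "product_sum (m * k) (\<lambda>x. F x + G x)"
      using Suc unfolding G_def by simp
    ultimately have "product_sum (m * k + k) (\<lambda>x. F x + G (x(Suc m := p (x (Suc m)))))"
      using product_sum_add[of "m * k" "\<lambda>x. F x + G x" k "\<lambda>x. G x + G (x(Suc m := p (x (Suc m))))"] by (simp add: add.assoc)
    moreover have "G (x(Suc m := p (x (Suc m)))) = F (\<lambda>j. if j \<in> {1..Suc m} then p (x j) else x j)" for x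
      unfolding G_def by (rule arg_cong[of _ _ F]) (auto simp: fun_eq_iff)
    ultimately show ?case by (simp add: add.commute)
  qed
  from this[OF _ order_refl]
  have total: "product_sum (5 * k) (\<lambda>x. F x + F (\<lambda>j. p (x j)))" if F: "multi {1..5} F" for F
  proof -
    have "F (\<lambda>j. if j \<in> {1..5} then p (x j) else x j) = F (\<lambda>j. p (x j))" for x
      by (intro multi_cong[OF F]) auto
    with \<open>\<And>F. multi {1..5} F \<Longrightarrow> product_sum (5 * k) _\<close>[OF F] show ?thesis by simp
  qed
  have "k \<le> 2 ^ card L" using k card_bit_span[OF fin] by simp
  then show ?thesis using that padd kill total by blast
qed

subsection \<open>Interpolating a form in a pair of coordinates\<close>

definition pair_interp ::
    "nat \<Rightarrow> (nat \<Rightarrow> 'a \<times> 'a \<Rightarrow> bit) \<Rightarrow> (nat \<Rightarrow> 'a \<times> 'a) \<Rightarrow> nat \<Rightarrow> nat \<Rightarrow>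
      ((nat \<Rightarrow> 'a) \<Rightarrow> bit) \<Rightarrow> (nat \<Rightarrow> 'a) \<Rightarrow> bit" where
  "pair_interp n g p a b F x = (\<Sum>i<n. g i (x a, x b) * F (x(a := fst (p i), b := snd (p i))))"

lemma pair_subset: "a \<in> {1..5} \<Longrightarrow> b \<in> {1..5} \<Longrightarrow> {a, b} \<subset> {1..5::nat}"
proof
  assume "a \<in> {1..5}" "b \<in> {1..5}"
  then show "{a, b} \<subseteq> {1..5::nat}" by auto
  show "{a, b} \<noteq> {1..5::nat}"
  proof
    assume "{a, b} = {1..5::nat}"
    moreover have "card {a, b} \<le> 2" by (simp add: card_insert_if)
    ultimately show False by simp
  qed
qed

lemma pair_interp_product_sum:
  assumes "\<And>i. i < n \<Longrightarrow> biadditive (g i)" "multi {1..5} F" "a \<in> {1..5}" "b \<in> {1..5}" "a \<noteq> b"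
  shows "product_sum n (pair_interp n g p a b F)"
proof -
  have "product_sum 1 (\<lambda>x. g i (x a, x b) * F (x(a := fst (p i), b := snd (p i))))" if "i < n" for i
    using assms that
    by (intro product_sum_single[of "{a, b}"] multi_biadditive multi_fix2 pair_subset) auto
  from product_sum_sum[of "{..<n}" 1, OF _ this]
  show ?thesis by (simp add: pair_interp_def[abs_def])
qed

lemma pair_interp_multi:
  assumes "\<And>i. i < n \<Longrightarrow> biadditive (g i)" "multi {1..5} F" "a \<in> {1..5}" "b \<in> {1..5}" "a \<noteq> b"
  shows "multi {1..5} (pair_interp n g p a b F)"
proof -
  have "multi ({a, b} \<union> ({1..5} - {a, b})) (\<lambda>x. g i (x a, x b) * F (x(a := fst (p i), b := snd (p i))))"
    if "i < n" for i
    using assms that by (intro multi_mult multi_biadditive multi_fix2) auto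
  moreover have "{a, b} \<union> ({1..5} - {a, b}) = {1..5}" using assms by auto
  ultimately show ?thesis
    unfolding pair_interp_def[abs_def] by (intro multi_sum) auto
qed

lemma pair_interp_dual:
  assumes "\<And>i j. i < n \<Longrightarrow> j < n \<Longrightarrow> g i (p j) = of_bool (i = j)" "j < n" "a \<noteq> b"
  shows "pair_interp n g p a b F (x(a := fst (p j), b := snd (p j))) = F (x(a := fst (p j), b := snd (p j)))"
proof -
  have upd: "x(a := u, b := v, a := u', b := v') = x(a := u', b := v')" for u v u' v'
    using assms(3) by (auto simp: fun_eq_iff)
  have "pair_interp n g p a b F (x(a := fst (p j), b := snd (p j))) =
      (\<Sum>i<n. if i = j then F (x(a := fst (p i), b := snd (p i))) else 0)"
    unfolding pair_interp_def using assms by (intro sum.cong) (auto simp: upd)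
  then show ?thesis using assms(2) by simp
qed

text \<open>Invariance of F moves the exchange from the argument to the pair of coordinates, so a
  transposition merely permutes interpolations of a symmetric form.\<close>

lemma pair_interp_transpose:
  assumes "\<And>y. F (y \<circ> transpose c d) = F y"
  shows "pair_interp n g p a b F (x \<circ> transpose c d) =
    pair_interp n g p (transpose c d a) (transpose c d b) F x"
proof -
  have "F ((x \<circ> transpose c d)(a := u, b := v)) = F (x(transpose c d a := u, transpose c d b := v))" for u v
    using assms[of "x(transpose c d a := u, transpose c d b := v)"]
    by (simp add: fun_upd_comp_transpose)
  then show ?thesis by (simp add: pair_interp_def)
qed

text \<open>This is where symmetric basis forms pay off: reversing the coordinates reverses both the
  arguments of \<open>g i\<close> and the substituted pair, and the second reversal is absorbed by
  F.\<close>

lemma pair_interp_flip: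
  assumes "\<And>y. F (y \<circ> transpose a b) = F y" "\<And>i u v. i < n \<Longrightarrow> g i (v, u) = g i (u, v)" "a \<noteq> b"
  shows "pair_interp n g p b a F x = pair_interp n g p a b F x"
proof -
  have "F (x(b := u, a := v)) = F (x(a := u, b := v))" for u v
  proof -
    have "x(b := u, a := v) = x(a := u, b := v) \<circ> transpose a b"
      using assms(3) by (auto simp: fun_eq_iff transpose_def)
    then show ?thesis using assms(1) by simp
  qed
  then show ?thesis unfolding pair_interp_def using assms(2) by (intro sum.cong) auto
qed

text \<open>
  In \<open>elementary V X U\<close>, the last condition says that the second factor degenerates once two of
  its three coordinates are taken from a pair in \<open>X\<close> and the third one from \<open>U\<close>.
\<close>

definition elementary ::
    "('a::ab_group_add \<times> 'a \<Rightarrow> bit) set \<Rightarrow> ('a \<times> 'a) set \<Rightarrow> 'a set \<Rightarrow> ((nat \<Rightarrow> 'a) \<Rightarrow> bit) \<Rightarrow> bool" where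
  "elementary V X U F \<longleftrightarrow> (\<exists>c d \<beta> \<tau>. c \<in> {1..5} \<and> d \<in> {1..5} \<and> c \<noteq> d \<and> \<beta> \<in> V \<and>
     multi ({1..5} - {c, d}) \<tau> \<and> F = (\<lambda>x. \<beta> (x c, x d) * \<tau> x) \<and>
     (\<forall>a\<in>{1..5} - {c, d}. \<forall>b\<in>{1..5} - {c, d}. a \<noteq> b \<longrightarrow> (\<forall>(u, v)\<in>X. \<forall>x. range x \<subseteq> U \<longrightarrow>
        \<tau> (x(a := u, b := v)) = 0)))"

text \<open>The transposition relabels the pair c, d, and the degeneracy condition ranges over all
  pairs of remaining coordinates, so it is carried along. This is needed because a defect involves
  both a form and its transposed copy.\<close>

lemma elementary_transpose:
  assumes F: "elementary V X U F" and e: "e \<in> {1..5}" and f: "f \<in> {1..5}"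
  shows "elementary V X U (\<lambda>x. F (x \<circ> transpose e f))"
proof -
  let ?t = "transpose e f"
  obtain c d \<beta> \<tau> where cd: "c \<in> {1..5}" "d \<in> {1..5}" "c \<noteq> d" "\<beta> \<in> V"
    and \<tau>: "multi ({1..5} - {c, d}) \<tau>" and Feq: "F = (\<lambda>x. \<beta> (x c, x d) * \<tau> x)"
    and kill: "\<And>a b u v x. a \<in> {1..5} - {c, d} \<Longrightarrow> b \<in> {1..5} - {c, d} \<Longrightarrow> a \<noteq> b \<Longrightarrow> (u, v) \<in> X \<Longrightarrow>
      range x \<subseteq> U \<Longrightarrow> \<tau> (x(a := u, b := v)) = 0"
    using F unfolding elementary_def by blast
  have t5: "?t a \<in> {1..5} \<longleftrightarrow> a \<in> {1..5}" for a
    using e f by (auto simp: transpose_def)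
  have img: "?t ` ({1..5} - {c, d}) = {1..5} - {?t c, ?t d}"
    using e f by (simp add: image_set_diff transpose_image_eq)
  show ?thesis
    unfolding elementary_def
  proof (intro exI conjI ballI impI allI)
    show "?t c \<in> {1..5}" "?t d \<in> {1..5}" using cd t5 by auto
    show "?t c \<noteq> ?t d" using cd(3) by (metis transpose_involutory)
    show "\<beta> \<in> V" by fact
    show "multi ({1..5} - {?t c, ?t d}) (\<lambda>x. \<tau> (x \<circ> ?t))"
      using multi_transpose[OF \<tau>, of e f] img by simp
    show "(\<lambda>x. F (x \<circ> ?t)) = (\<lambda>x. \<beta> (x (?t c), x (?t d)) * \<tau> (x \<circ> ?t))"
      by (simp add: Feq)
  next
    fix a b uv
    assume a: "a \<in> {1..5} - {?t c, ?t d}" and b: "b \<in> {1..5} - {?t c, ?t d}" and ab: "a \<noteq> b"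
      and uv: "uv \<in> X"
    have tinj: "?t i = j \<longleftrightarrow> i = ?t j" for i j by (metis transpose_involutory)
    have ta: "?t a \<in> {1..5} - {c, d}" "?t b \<in> {1..5} - {c, d}" "?t a \<noteq> ?t b"
      using a b ab t5 tinj by auto
    show "case uv of (u, v) \<Rightarrow> \<forall>x. range x \<subseteq> U \<longrightarrow> \<tau> (x(a := u, b := v) \<circ> ?t) = 0"
    proof (clarsimp split: prod.split simp: fun_upd_comp_transpose)
      fix u v and x :: "nat \<Rightarrow> 'a" assume x: "range x \<subseteq> U" and "uv = (u, v)"
      have "range (x \<circ> ?t) \<subseteq> U" using x by auto
      then show "\<tau> ((x \<circ> ?t)(?t a := u, ?t b := v)) = 0"
        using kill[OF ta] uv \<open>uv = (u, v)\<close> by blast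
    qed
  qed
qed

section \<open>Forms that are determined on U by their values at dual points\<close>

locale dual_system =
  fixes V :: "('a::ab_group_add \<times> 'a \<Rightarrow> bit) set" and X :: "('a \<times> 'a) set" and U :: "'a set"
    and l :: nat and h :: "nat \<Rightarrow> 'a \<times> 'a \<Rightarrow> bit" and q :: "nat \<Rightarrow> 'a \<times> 'a"
  assumes swap_V: "\<And>\<beta>. \<beta> \<in> V \<Longrightarrow> \<beta> \<circ> prod.swap \<in> V"
    and q_X: "\<And>j. j < l \<Longrightarrow> q j \<in> X"
    and expand: "\<And>\<beta> y. \<beta> \<in> V \<Longrightarrow> \<beta> y = (\<Sum>j<l. \<beta> (q j) * h j y)"
    and orth: "\<And>\<beta> u v w. \<beta> \<in> V \<Longrightarrow> (u, v) \<in> X \<Longrightarrow> w \<in> U \<Longrightarrow>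
      \<beta> (u, w) = 0 \<and> \<beta> (w, u) = 0 \<and> \<beta> (v, w) = 0 \<and> \<beta> (w, v) = 0"
begin

definition pairs :: "(nat \<times> nat) set" where
  "pairs = {(a, b). a \<in> {1..5} \<and> b \<in> {1..5} \<and> a < b}"

text \<open>Two identities, linear in F, for points with all coordinates in U, where the unwanted
  linear factors vanish. The first extends information from the points \<open>q j\<close> to all of
  X; by the second, F is zero on U as soon as all its pair components are.\<close>

definition tame :: "((nat \<Rightarrow> 'a) \<Rightarrow> bit) \<Rightarrow> bool" where
  "tame F \<longleftrightarrow>
     (\<forall>a\<in>{1..5}. \<forall>b\<in>{1..5}. a \<noteq> b \<longrightarrow> (\<forall>(u, v)\<in>X. \<forall>x. range x \<subseteq> U \<longrightarrow>
        F (x(a := u, b := v)) = (\<Sum>j<l. h j (u, v) * F (x(a := fst (q j), b := snd (q j)))))) \<and>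
     (\<forall>x. range x \<subseteq> U \<longrightarrow> F x = (\<Sum>(a, b)\<in>pairs. pair_interp l h q a b F x))"

lemma finite_pairs: "finite pairs"
  by (rule finite_subset[of _ "{1..5} \<times> {1..5}"]) (auto simp: pairs_def)

lemma tame_zero: "tame (\<lambda>_. 0)"
  by (simp add: tame_def pair_interp_def)

lemma tame_add:
  assumes "tame F" "tame G"
  shows "tame (\<lambda>x. F x + G x)"
proof -
  have "pair_interp l h q a b (\<lambda>x. F x + G x) x =
      pair_interp l h q a b F x + pair_interp l h q a b G x" for a b x
    by (simp add: pair_interp_def distrib_left sum.distrib)
  then have "(\<Sum>(a, b)\<in>pairs. pair_interp l h q a b (\<lambda>x. F x + G x) x) =
      (\<Sum>(a, b)\<in>pairs. pair_interp l h q a b F x) + (\<Sum>(a, b)\<in>pairs. pair_interp l h q a b G x)" for x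
    by (simp add: case_prod_beta sum.distrib)
  moreover have "(\<Sum>j<l. h j (u, v) * (F (y j) + G (y j))) =
      (\<Sum>j<l. h j (u, v) * F (y j)) + (\<Sum>j<l. h j (u, v) * G (y j))" for u v y
    by (simp add: distrib_left sum.distrib)
  ultimately show ?thesis
    using assms unfolding tame_def by (auto split: prod.splits)
qed

lemma tame_sum: "(\<And>i. i \<in> A \<Longrightarrow> tame (G i)) \<Longrightarrow> tame (\<lambda>x. \<Sum>i\<in>A. G i x)"
  by (induction A rule: infinite_finite_induct) (auto intro: tame_zero tame_add)

text \<open>If the pairs share exactly one index, \<beta> receives one entry from a pair in X and
  one from U, and \<open>orth\<close> applies; if they are disjoint, the other factor vanishes by
  \<open>kill\<close>.\<close>

lemma elementary_vanish:
  assumes cd: "c \<noteq> d" "\<beta> \<in> V"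
    and kill: "\<And>x. c \<notin> {a, b} \<Longrightarrow> d \<notin> {a, b} \<Longrightarrow> range x \<subseteq> U \<Longrightarrow> \<tau> (x(a := u, b := v)) = 0"
    and ab: "a \<noteq> b" "{a, b} \<noteq> {c, d}" and uv: "(u, v) \<in> X" and x: "range x \<subseteq> U"
  shows "\<beta> ((x(a := u, b := v)) c, (x(a := u, b := v)) d) * \<tau> (x(a := u, b := v)) = 0"
proof -
  have xU: "x i \<in> U" for i using x by auto
  note o = orth[OF cd(2) uv xU]
  consider "c = a" "d \<notin> {a, b}" | "c = b" "d \<notin> {a, b}" | "d = a" "c \<notin> {a, b}" | "d = b" "c \<notin> {a, b}"
    | "c \<notin> {a, b}" "d \<notin> {a, b}"
    using ab cd(1) by blast
  then show ?thesis
  proof cases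
    case 5
    then show ?thesis using kill x by simp
  qed (use o[of d] o[of c] ab in auto)
qed

text \<open>Substituting from X at a pair other than {c, d} gives zero. At {c, d} the second factor
  is constant, and both identities reduce to the expansion of a member of V.\<close>

lemma elementary_tame:
  assumes "elementary V X U F"
  shows "tame F"
proof -
  obtain c0 d0 \<beta>0 \<tau> where cd0: "c0 \<in> {1..5}" "d0 \<in> {1..5}" "c0 \<noteq> d0" "\<beta>0 \<in> V"
    and \<tau>0: "multi ({1..5} - {c0, d0}) \<tau>" and F0: "F = (\<lambda>x. \<beta>0 (x c0, x d0) * \<tau> x)"
    and kill0: "\<And>a b u v x. a \<in> {1..5} - {c0, d0} \<Longrightarrow> b \<in> {1..5} - {c0, d0} \<Longrightarrow> a \<noteq> b \<Longrightarrow> (u, v) \<in> X \<Longrightarrow>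
      range x \<subseteq> U \<Longrightarrow> \<tau> (x(a := u, b := v)) = 0"
    using assms unfolding elementary_def by blast
  \<comment> \<open>\<open>pairs\<close> lists increasing pairs only; putting c below d may exchange
    the arguments of the bilinear factor, which stays in V by \<open>swap_V\<close>.\<close>
  define c d \<beta> where "c = min c0 d0" and "d = max c0 d0"
    and "\<beta> = (if c0 < d0 then \<beta>0 else \<beta>0 \<circ> prod.swap)"
  have cd: "c \<in> {1..5}" "d \<in> {1..5}" "c < d" "\<beta> \<in> V" "{c, d} = {c0, d0}"
    using cd0 swap_V by (auto simp: c_def d_def \<beta>_def min_def max_def)
  have \<tau>: "multi ({1..5} - {c, d}) \<tau>" using \<tau>0 cd(5) by simp
  have F: "F x = \<beta> (x c, x d) * \<tau> x" for x
    using cd0(3) by (auto simp: F0 c_def d_def \<beta>_def min_def max_def)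
  have const: "\<tau> (x(a := u, b := v)) = \<tau> x" if "{a, b} = {c, d}" for a b u v x
    using that by (intro multi_cong[OF \<tau>]) auto
  have zero: "F (x(a := u, b := v)) = 0"
    if ab: "a \<in> {1..5}" "b \<in> {1..5}" "a \<noteq> b" "{a, b} \<noteq> {c, d}" and uv: "(u, v) \<in> X" and x: "range x \<subseteq> U"
    for a b u v x
    unfolding F
  proof (rule elementary_vanish[OF _ cd(4) _ ab(3,4) uv x])
    show "c \<noteq> d" using cd(3) by simp
    fix y :: "nat \<Rightarrow> 'a" assume "c \<notin> {a, b}" "d \<notin> {a, b}" "range y \<subseteq> U"
    then have "a \<notin> {c, d}" "b \<notin> {c, d}" by auto
    then show "\<tau> (y(a := u, b := v)) = 0"
      using ab uv \<open>range y \<subseteq> U\<close> kill0[of a b u v y] unfolding cd(5) by blast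
  qed
  have at: "F (x(a := u, b := v)) = (\<Sum>j<l. h j (u, v) * F (x(a := fst (q j), b := snd (q j))))"
    if ab: "a \<in> {1..5}" "b \<in> {1..5}" "a \<noteq> b" and uv: "(u, v) \<in> X" and x: "range x \<subseteq> U" for a b u v x
  proof (cases "{a, b} = {c, d}")
    case True
    \<comment> \<open>The pair (a, b) may be (c, d) or (d, c).\<close>
    define \<beta>' where "\<beta>' = (if a = c then \<beta> else \<beta> \<circ> prod.swap)"
    have "\<beta>' \<in> V" using cd(4) swap_V by (simp add: \<beta>'_def)
    have F': "F (x(a := u', b := v')) = \<beta>' (u', v') * \<tau> x" for u' v'
    proof -
      have "a = c \<and> b = d \<or> a = d \<and> b = c" using True by (auto simp: doubleton_eq_iff)
      then show ?thesis using ab(3) const[OF True] by (auto simp: F \<beta>'_def)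
    qed
    show ?thesis
      by (simp add: F' expand[OF \<open>\<beta>' \<in> V\<close>, of "(u, v)"] sum_distrib_left sum_distrib_right mult_ac)
  next
    case False
    have "F (x(a := fst (q j), b := snd (q j))) = 0" if "j < l" for j
      using zero[OF ab False _ x] q_X[OF that] by simp
    then show ?thesis using zero[OF ab False uv x] by simp
  qed
  have "F x = (\<Sum>(a, b)\<in>pairs. pair_interp l h q a b F x)" if x: "range x \<subseteq> U" for x
  proof -
    have single: "pair_interp l h q a b F x = (if (a, b) = (c, d) then F x else 0)"
      if "(a, b) \<in> pairs" for a b
    proof (cases "(a, b) = (c, d)")
      case True
      have "pair_interp l h q a b F x = (\<Sum>j<l. \<beta> (q j) * h j (x c, x d)) * \<tau> x"
        using True cd(3) const[of c d x] by (simp add: pair_interp_def F sum_distrib_left sum_distrib_right mult_ac)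
      then show ?thesis using True expand[OF cd(4), of "(x c, x d)"] by (simp add: F)
    next
      case False
      have ab: "a \<in> {1..5}" "b \<in> {1..5}" "a \<noteq> b" "{a, b} \<noteq> {c, d}"
        using that False cd(3) by (auto simp: pairs_def doubleton_eq_iff)
      have "F (x(a := fst (q j), b := snd (q j))) = 0" if "j < l" for j
        using zero[OF ab _ x] q_X[OF that] by simp
      then show ?thesis using False by (auto simp: pair_interp_def)
    qed
    have "(\<Sum>(a, b)\<in>pairs. pair_interp l h q a b F x) = (\<Sum>ab\<in>pairs. if ab = (c, d) then F x else 0)"
    proof (rule sum.cong[OF refl])
      fix ab assume "ab \<in> pairs"
      then show "(case ab of (a, b) \<Rightarrow> pair_interp l h q a b F x) = (if ab = (c, d) then F x else 0)"
        using single[of "fst ab" "snd ab"] by (simp add: case_prod_beta)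
    qed
    also have "\<dots> = F x"
      using cd finite_pairs by (simp add: pairs_def)
    finally show ?thesis by simp
  qed
  with at show ?thesis unfolding tame_def by (auto split: prod.splits)
qed

lemma pairs_cases:
  assumes "(a, b) \<in> pairs"
  obtains "a = 1" "b = 2" | "a = 1" "b = 3" | "a = 2" "b = 3" | "a = 1" "b = 4" | "a = 2" "b = 4"
    | "a = 3" "b = 4" | "a = 1" "b = 5" | "a = 2" "b = 5" | "a = 3" "b = 5" | "a = 4" "b = 5"
proof -
  have "a \<in> {1, 2, 3, 4, 5}" "b \<in> {1, 2, 3, 4, 5}" "a < b"
    using assms by (auto simp: pairs_def)
  then show ?thesis using that by auto
qed

text \<open>
  The coordinates \<open>(3, 4)\<close> are the delicate ones: exchanging them reverses a pair \<open>q j\<close>, and the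
  reversed pair need not be among the \<open>q j\<close>.  Tameness at \<open>(2, 4)\<close> covers all of \<open>X\<close>.
\<close>

lemma defect_vanishes:
  assumes sym23: "\<And>x. F (x \<circ> transpose 2 3) = F x"
    and swap_X: "\<And>u v. (u, v) \<in> X \<Longrightarrow> (v, u) \<in> X"
    and tame: "tame (\<lambda>x. F x + F (x \<circ> transpose 3 4))"
    and low: "\<And>a b u v x. (a, b) \<in> {(1, 2), (1, 3), (2, 3)} \<Longrightarrow> (u, v) \<in> X \<Longrightarrow> range x \<subseteq> U \<Longrightarrow>
      F (x(a := u, b := v)) = 0"
    and high: "\<And>a b j x. (a, b) \<in> {(1, 4), (2, 4), (3, 4), (1, 5), (2, 5), (3, 5), (4, 5)} \<Longrightarrow> j < l \<Longrightarrow>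
      range x \<subseteq> U \<Longrightarrow> F (x(a := fst (q j), b := snd (q j))) = 0"
    and x: "range x \<subseteq> U"
  shows "F x + F (x \<circ> transpose 3 4) = 0"
proof -
  let ?S = "\<lambda>x. F x + F (x \<circ> transpose 3 4)"
  have rng: "range (y \<circ> transpose a b) \<subseteq> U" if "range y \<subseteq> U" for y and a b :: nat
    using that by auto
  \<comment> \<open>Exchanging 3 and 4 turns a substitution at (2, 4) into one at (2, 3), where F
    vanishes on all of X; so here the defect equals F.\<close>
  have S24: "?S (y(2 := u, 4 := v)) = F (y(2 := u, 4 := v))" if "(u, v) \<in> X" "range y \<subseteq> U" for u v y
    using low[of 2 3 u v, OF _ that(1) rng[OF that(2), of 3 4]] by (simp add: fun_upd_comp_transpose)
  \<comment> \<open>\<open>high\<close> covers only the points \<open>q j\<close>; tameness of the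
    defect spreads the vanishing to every pair in X.\<close>
  have F24: "F (y(2 := u, 4 := v)) = 0" if uv: "(u, v) \<in> X" and y: "range y \<subseteq> U" for u v y
  proof -
    have "?S (y(2 := u, 4 := v)) = (\<Sum>j<l. h j (u, v) * ?S (y(2 := fst (q j), 4 := snd (q j))))"
      using tame uv y unfolding tame_def by (auto split: prod.splits)
    also have "\<dots> = (\<Sum>j<l. h j (u, v) * F (y(2 := fst (q j), 4 := snd (q j))))"
      using S24[OF _ y] q_X by (intro sum.cong) auto
    also have "\<dots> = 0"
      using high[of 2 4 _ y] y by (intro sum.neutral) auto
    finally show ?thesis using S24[OF uv y] by simp
  qed
  \<comment> \<open>Symmetry in the coordinates 2 and 3 carries (2, 4) to (3, 4), still for every
    pair in X and hence also for reversed ones.\<close>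
  have F34: "F (y(3 := u, 4 := v)) = 0" if uv: "(u, v) \<in> X" and y: "range y \<subseteq> U" for u v y
    using F24[OF uv rng[OF y, of 2 3]] sym23[of "y(3 := u, 4 := v)"] by (simp add: fun_upd_comp_transpose)
  have F43: "F (y(4 := u, 3 := v)) = 0" if "(u, v) \<in> X" and "range y \<subseteq> U" for u v y
    using F34[OF swap_X[OF that(1)] that(2)] by (simp add: fun_upd_twist[of 4 3])
  \<comment> \<open>Now every component of the defect vanishes at the dual points. At (3, 4) the
    transposed term is a substitution at (4, 3), covered by \<open>F43\<close>.\<close>
  have "?S (x(a := fst (q j), b := snd (q j))) = 0" if "(a, b) \<in> pairs" "j < l" for a b j
  proof -
    note qj = q_X[OF that(2)]
    have qj': "(fst (q j), snd (q j)) \<in> X" using qj by simp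
    note lx = low[OF _ qj' x] low[OF _ qj' rng[OF x, of 3 4]]
    note hx = high[OF _ that(2) x] high[OF _ that(2) rng[OF x, of 3 4]]
    show ?thesis
      using that(1) by (cases rule: pairs_cases)
        (use lx hx F34[OF qj' x] F43[OF qj' rng[OF x, of 3 4]] in \<open>simp_all add: fun_upd_comp_transpose\<close>)
  qed
  then have "pair_interp l h q a b ?S x = 0" if "(a, b) \<in> pairs" for a b
    unfolding pair_interp_def using that by (intro sum.neutral) auto
  then have "(\<Sum>(a, b)\<in>pairs. pair_interp l h q a b ?S x) = 0"
    by (intro sum.neutral) auto
  then show ?thesis using tame x unfolding tame_def by auto
qed

end

subsection \<open>Correcting a form by its components\<close>

text \<open>(g, p) is the dual system for symmetric members of V, (h, q) the one for V; they meet in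
  X, which contains the \<open>p i\<close>, their reversals and the \<open>q j\<close>.
  \<open>f_kill\<close> is where five variables enter: two pairs from X leave one coordinate, taken
  from U.\<close>

locale symmetrization = dual_system V X U l h q
  for V :: "('a::ab_group_add \<times> 'a \<Rightarrow> bit) set" and X U l h q +
  fixes k :: nat and g :: "nat \<Rightarrow> 'a \<times> 'a \<Rightarrow> bit" and p :: "nat \<Rightarrow> 'a \<times> 'a"
    and f :: "(nat \<Rightarrow> 'a) \<Rightarrow> bit"
  assumes V_biadditive: "\<And>\<beta>. \<beta> \<in> V \<Longrightarrow> biadditive \<beta>"
    and h_V: "\<And>j. j < l \<Longrightarrow> h j \<in> V"
    and h_dual: "\<And>i j. i < l \<Longrightarrow> j < l \<Longrightarrow> h i (q j) = of_bool (i = j)"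
    and g_V: "\<And>i. i < k \<Longrightarrow> g i \<in> V"
    and g_dual: "\<And>i j. i < k \<Longrightarrow> j < k \<Longrightarrow> g i (p j) = of_bool (i = j)"
    and g_sym: "\<And>i u v. i < k \<Longrightarrow> g i (v, u) = g i (u, v)"
    and X_eq: "X = p ` {..<k} \<union> prod.swap ` p ` {..<k}"
    and f_multi: "multi {1..5} f"
    and f_sym: "\<And>x a b. (a, b) \<in> {(1, 2), (1, 3), (2, 3)} \<Longrightarrow> f (x \<circ> transpose a b) = f x"
    and f_kill: "\<And>a b c d u v u' v' x. {a, b, c, d} \<subseteq> {1..5} \<Longrightarrow> distinct [a, b, c, d] \<Longrightarrow>
      (u, v) \<in> X \<Longrightarrow> (u', v') \<in> X \<Longrightarrow> range x \<subseteq> U \<Longrightarrow> f (x(a := u, b := v, c := u', d := v')) = 0"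
    and f_tame: "tame (\<lambda>x. f x + f (x \<circ> transpose 3 4))"
begin

abbreviation G :: "nat \<Rightarrow> nat \<Rightarrow> (nat \<Rightarrow> 'a) \<Rightarrow> bit" where
  "G a b \<equiv> pair_interp k g p a b f"

abbreviation H :: "nat \<Rightarrow> nat \<Rightarrow> (nat \<Rightarrow> 'a) \<Rightarrow> bit" where
  "H a b \<equiv> pair_interp l h q a b f"

text \<open>A permutation of {1, 2, 3} can reverse a pair inside this set, hence the symmetric
  \<open>g i\<close> there. It never reverses an increasing pair that meets {4, 5}, so those seven
  pairs can be interpolated with all of V.\<close>

definition correction :: "(nat \<Rightarrow> 'a) \<Rightarrow> bit" where
  "correction x = G 1 2 x + G 1 3 x + G 2 3 x +
     (H 1 4 x + H 2 4 x + H 3 4 x + (H 1 5 x + H 2 5 x + H 3 5 x + H 4 5 x))"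

lemma p_X: "i < k \<Longrightarrow> p i \<in> X"
  by (simp add: X_eq)

lemma X_iff: "(u, v) \<in> X \<longleftrightarrow> (\<exists>i<k. (u, v) = p i \<or> (v, u) = p i)"
proof -
  have "(u, v) = prod.swap y \<longleftrightarrow> (v, u) = y" for y by (cases y) auto
  moreover have "(u, v) \<in> X \<longleftrightarrow> (\<exists>i<k. (u, v) = p i \<or> (u, v) = prod.swap (p i))"
    by (auto simp only: X_eq Un_iff image_iff lessThan_iff bex_simps)
  ultimately show ?thesis by simp
qed

lemma swap_X: "(u, v) \<in> X \<Longrightarrow> (v, u) \<in> X"
  unfolding X_iff by blast

lemma correction_multi: "multi {1..5} correction"
  unfolding correction_def[abs_def]
  by (intro multi_add pair_interp_multi f_multi) (auto intro: V_biadditive g_V h_V)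

lemma correction_product_sum: "product_sum (3 * k + 7 * l) correction"
proof -
  have G: "product_sum k (G a b)" if "a \<in> {1..5}" "b \<in> {1..5}" "a \<noteq> b" for a b
    using that by (intro pair_interp_product_sum V_biadditive g_V f_multi)
  have H: "product_sum l (H a b)" if "a \<in> {1..5}" "b \<in> {1..5}" "a \<noteq> b" for a b
    using that by (intro pair_interp_product_sum V_biadditive h_V f_multi)
  have "product_sum (k + k + k + (l + l + l + (l + l + l + l))) correction"
    unfolding correction_def[abs_def] by (intro product_sum_add G H) auto
  moreover have "k + k + k + (l + l + l + (l + l + l + l)) = 3 * k + 7 * l" by simp
  ultimately show ?thesis by metis
qed

lemma G_flip: "(a, b) \<in> {(1, 2), (1, 3), (2, 3)} \<Longrightarrow> G b a x = G a b x"
  by (rule pair_interp_flip) (auto simp: f_sym g_sym)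

lemma correction_sym:
  assumes "(a, b) \<in> {(1, 2), (1, 3), (2, 3)}"
  shows "correction (x \<circ> transpose a b) = correction x"
proof -
  have flip: "G 2 1 x = G 1 2 x" "G 3 1 x = G 1 3 x" "G 3 2 x = G 2 3 x" by (simp_all add: G_flip)
  note t = pair_interp_transpose[of f 1 2, OF f_sym] pair_interp_transpose[of f 1 3, OF f_sym]
    pair_interp_transpose[of f 2 3, OF f_sym]
  consider "a = 1" "b = 2" | "a = 1" "b = 3" | "a = 2" "b = 3" using assms by auto
  then show ?thesis
    by cases (simp_all add: correction_def t flip transpose_def ac_simps del: One_nat_def)
qed

text \<open>The degeneracy of the second factor is \<open>f_kill\<close>: a second, disjoint pair
  from X is substituted.\<close>

lemma term_elementary:
  assumes "c \<in> {1..5}" "d \<in> {1..5}" "c \<noteq> d" "\<beta> \<in> V" "y \<in> X"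
  shows "elementary V X U (\<lambda>x. \<beta> (x c, x d) * f (x(c := fst y, d := snd y)))"
  unfolding elementary_def
proof (intro exI conjI ballI impI)
  show "multi ({1..5} - {c, d}) (\<lambda>x. f (x(c := fst y, d := snd y)))"
    by (rule multi_fix2[OF f_multi])
next
  fix a b uv assume ab: "a \<in> {1..5} - {c, d}" "b \<in> {1..5} - {c, d}" "a \<noteq> b" and uv: "uv \<in> X"
  show "case uv of (u, v) \<Rightarrow> \<forall>x. range x \<subseteq> U \<longrightarrow> f (x(a := u, b := v, c := fst y, d := snd y)) = 0"
    using ab uv assms f_kill[of a b c d "fst uv" "snd uv" "fst y" "snd y"] by (cases uv) auto
qed (use assms in auto)

lemma interp_tame:
  assumes "\<And>i. i < n \<Longrightarrow> \<gamma> i \<in> V" "\<And>i. i < n \<Longrightarrow> y i \<in> X"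
    and cd: "c \<in> {1..5}" "d \<in> {1..5}" "c \<noteq> d"
  shows "tame (pair_interp n \<gamma> y c d f)" "tame (\<lambda>x. pair_interp n \<gamma> y c d f (x \<circ> transpose 3 4))"
proof -
  let ?E = "\<lambda>i x. \<gamma> i (x c, x d) * f (x(c := fst (y i), d := snd (y i)))"
  have E: "elementary V X U (?E i)" if "i < n" for i
    using assms that by (intro term_elementary) auto
  then show "tame (pair_interp n \<gamma> y c d f)"
    unfolding pair_interp_def[abs_def] by (intro tame_sum elementary_tame) auto
  have "elementary V X U (\<lambda>x. ?E i (x \<circ> transpose 3 4))" if "i < n" for i
    by (rule elementary_transpose[OF E[OF that]]) auto
  then show "tame (\<lambda>x. pair_interp n \<gamma> y c d f (x \<circ> transpose 3 4))"
    unfolding pair_interp_def by (intro tame_sum elementary_tame) auto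
qed

lemma correction_tame: "tame correction" "tame (\<lambda>x. correction (x \<circ> transpose 3 4))"
  unfolding correction_def[abs_def]
  by (intro tame_add interp_tame; auto intro: g_V h_V p_X q_X)+

text \<open>Consequently a substitution from X leaves only that summand of \<open>correction\<close>
  which belongs to the same pair of coordinates.\<close>

lemma interp_vanish:
  assumes n: "\<And>i. i < n \<Longrightarrow> \<gamma> i \<in> V" "\<And>i. i < n \<Longrightarrow> y i \<in> X"
    and cd: "c \<in> {1..5}" "d \<in> {1..5}" "c \<noteq> d" and ab: "a \<in> {1..5}" "b \<in> {1..5}" "a \<noteq> b"
    and neq: "{a, b} \<noteq> {c, d}" and uv: "(u, v) \<in> X" and x: "range x \<subseteq> U"
  shows "pair_interp n \<gamma> y c d f (x(a := u, b := v)) = 0"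
  unfolding pair_interp_def
proof (rule sum.neutral, rule ballI)
  fix i assume "i \<in> {..<n}"
  then have i: "\<gamma> i \<in> V" "y i \<in> X" using n by auto
  show "\<gamma> i ((x(a := u, b := v)) c, (x(a := u, b := v)) d) *
      f (x(a := u, b := v, c := fst (y i), d := snd (y i))) = 0"
  proof (rule elementary_vanish[OF cd(3) i(1) _ ab(3) neq uv x, of "\<lambda>x. f (x(c := fst (y i), d := snd (y i)))"])
    fix z :: "nat \<Rightarrow> 'a" assume "c \<notin> {a, b}" "d \<notin> {a, b}" "range z \<subseteq> U"
    then show "f (z(a := u, b := v, c := fst (y i), d := snd (y i))) = 0"
      using ab cd uv i(2) by (intro f_kill) auto
  qed
qed

text \<open>Duality gives this at the \<open>p i\<close>. At a reversed \<open>p i\<close> both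
  sides may be reversed, f by its symmetry and the interpolation by \<open>G_flip\<close>.\<close>

lemma G_reproduces:
  assumes ab: "(a, b) \<in> {(1, 2), (1, 3), (2, 3)}" and uv: "(u, v) \<in> X"
  shows "G a b (x(a := u, b := v)) = f (x(a := u, b := v))"
proof -
  have neq: "a \<noteq> b" using ab by auto
  have main: "G a b (y(a := fst (p i), b := snd (p i))) = f (y(a := fst (p i), b := snd (p i)))"
    if "i < k" for i y
    by (rule pair_interp_dual[OF g_dual that neq])
  obtain i where i: "i < k" "(u, v) = p i \<or> (v, u) = p i"
    using uv unfolding X_iff by metis
  from i(2) show ?thesis
  proof
    assume "(u, v) = p i"
    then show ?thesis using main[OF i(1), of x] by (metis fst_conv snd_conv)
  next
    assume "(v, u) = p i"
    then have vu: "v = fst (p i)" "u = snd (p i)" by (metis fst_conv, metis snd_conv)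
    define y where "y = x(a := v, b := u)"
    have swap: "x(a := u, b := v) = y \<circ> transpose a b"
      using neq by (auto simp: y_def fun_eq_iff transpose_def)
    have "G a b (y \<circ> transpose a b) = G b a y"
      using pair_interp_transpose[of f a b, OF f_sym[OF ab]] by simp
    also have "\<dots> = f y" using G_flip[OF ab] main[OF i(1), of x] by (simp add: y_def vu)
    also have "\<dots> = f (y \<circ> transpose a b)" using f_sym[OF ab] by simp
    finally show ?thesis by (simp add: swap)
  qed
qed

lemma corrected_low:
  assumes "(a, b) \<in> {(1, 2), (1, 3), (2, 3)}" "(u, v) \<in> X" "range x \<subseteq> U"
  shows "f (x(a := u, b := v)) + correction (x(a := u, b := v)) = 0"
proof -
  have ab: "a \<in> {1..5}" "b \<in> {1..5}" "a \<noteq> b" using assms(1) by auto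
  note Gv = interp_vanish[of k g p, OF g_V p_X _ _ _ ab _ assms(2,3)]
  note Hv = interp_vanish[of l h q, OF h_V q_X _ _ _ ab _ assms(2,3)]
  have Hzero: "H c d (x(a := u, b := v)) = 0" if "(c, d) \<in> {(1, 4), (2, 4), (3, 4), (1, 5), (2, 5), (3, 5), (4, 5)}" for c d
    using that assms(1) by (intro Hv) (auto simp: doubleton_eq_iff)
  have Gzero: "G c d (x(a := u, b := v)) = 0" if "(c, d) \<in> {(1, 2), (1, 3), (2, 3)} - {(a, b)}" for c d
    using that assms(1) by (intro Gv) (auto simp: doubleton_eq_iff)
  have "correction (x(a := u, b := v)) = G a b (x(a := u, b := v))"
    using assms(1) Gzero[of 1 2] Gzero[of 1 3] Gzero[of 2 3]
    by (auto simp: correction_def Hzero simp del: One_nat_def)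
  then show ?thesis using G_reproduces[OF assms(1,2)] by simp
qed

text \<open>Only at the \<open>q j\<close>, where duality of h makes the interpolation exact; f has
  no symmetry in these pairs that would reach the rest of X.\<close>

lemma corrected_high:
  assumes "(a, b) \<in> {(1, 4), (2, 4), (3, 4), (1, 5), (2, 5), (3, 5), (4, 5)}" "j < l" "range x \<subseteq> U"
  shows "f (x(a := fst (q j), b := snd (q j))) + correction (x(a := fst (q j), b := snd (q j))) = 0"
proof -
  let ?x = "x(a := fst (q j), b := snd (q j))"
  have ab: "a \<in> {1..5}" "b \<in> {1..5}" "a \<noteq> b" using assms(1) by auto
  have uv: "(fst (q j), snd (q j)) \<in> X" using q_X[OF assms(2)] by simp
  note Gv = interp_vanish[of k g p, OF g_V p_X _ _ _ ab _ uv assms(3)]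
  note Hv = interp_vanish[of l h q, OF h_V q_X _ _ _ ab _ uv assms(3)]
  have Gzero: "G c d ?x = 0" if "(c, d) \<in> {(1, 2), (1, 3), (2, 3)}" for c d
    using that assms(1) by (intro Gv) (auto simp: doubleton_eq_iff)
  have Hzero: "H c d ?x = 0"
    if "(c, d) \<in> {(1, 4), (2, 4), (3, 4), (1, 5), (2, 5), (3, 5), (4, 5)} - {(a, b)}" for c d
    using that assms(1) by (intro Hv) (auto simp: doubleton_eq_iff)
  have "correction ?x = H a b ?x"
    using assms(1) Hzero[of 1 4] Hzero[of 2 4] Hzero[of 3 4] Hzero[of 1 5] Hzero[of 2 5]
      Hzero[of 3 5] Hzero[of 4 5]
    by (auto simp: correction_def Gzero simp del: One_nat_def)
  then show ?thesis using pair_interp_dual[OF h_dual assms(2) ab(3), of f x] by simp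
qed

lemma corrected_invariant:
  assumes "range x \<subseteq> U"
  shows "f (x \<circ> transpose 3 4) + correction (x \<circ> transpose 3 4) = f x + correction x"
proof -
  let ?F = "\<lambda>x. f x + correction x"
  \<comment> \<open>The new defect is the sum of the old one, \<open>correction\<close> and its
    transposed copy, each of them tame.\<close>
  have tame: "tame (\<lambda>x. ?F x + ?F (x \<circ> transpose 3 4))"
    using tame_add[OF f_tame tame_add[OF correction_tame]] by (simp add: ac_simps)
  have "?F x + ?F (x \<circ> transpose 3 4) = 0"
  proof (rule defect_vanishes[of ?F, OF _ swap_X tame _ _ assms])
    show "?F (y \<circ> transpose 2 3) = ?F y" for y
      by (simp only: f_sym[of 2 3] correction_sym[of 2 3] insert_iff simp_thms)
  qed (assumption | rule corrected_low corrected_high)+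
  then show ?thesis by (metis add.right_neutral bit_add_left_self)
qed

end

section \<open>Choice of the spaces V and X and of the linear forms that cut out U\<close>

lemma biadditive_zero: "biadditive (\<lambda>_. 0)"
  by (simp add: biadditive_def additive_form_def)

lemma biadditive_add: "biadditive \<beta> \<Longrightarrow> biadditive \<gamma> \<Longrightarrow> biadditive (\<lambda>y. \<beta> y + \<gamma> y)"
  by (simp add: biadditive_def additive_form_def ac_simps)

lemma biadditive_swap: "biadditive \<beta> \<Longrightarrow> biadditive (\<beta> \<circ> prod.swap)"
  by (simp add: biadditive_def)

lemma fifth_index:
  assumes "{a, b, c, d} \<subseteq> {1..5::nat}" "distinct [a, b, c, d]"
  obtains e where "e \<in> {1..5}" "e \<notin> {a, b, c, d}" "{1..5} \<subseteq> {a, b, c, d, e}"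
proof -
  have "card {a, b, c, d} = 4" using assms(2) by simp
  then have "card ({1..5} - {a, b, c, d}) = 1"
    using card_Diff_subset[OF _ assms(1)] by simp
  then obtain e where "{1..5} - {a, b, c, d} = {e}" by (rule card_1_singletonE)
  then show ?thesis using that[of e] by blast
qed

text \<open>
  All counts are generous: dimensions of spaces are bounded by their cardinalities, which is
  affordable because the final bound is doubly exponential.
\<close>

lemma low_rank_correction:
  fixes f :: "(nat \<Rightarrow> 'a::ab_group_add) \<Rightarrow> bit" and r :: nat
  assumes f_multi: "multi {1..5} f"
    and f_sym: "\<And>x a b. (a, b) \<in> {(1, 2), (1, 3), (2, 3)} \<Longrightarrow> f (x \<circ> transpose a b) = f x"
    and defect: "\<And>x. f x + f (x \<circ> transpose 3 4) = (\<Sum>i = 1..r. \<beta> i (x (c i), x (d i)) * \<tau> i x)"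
    and cd: "\<And>i. i \<in> {1..r} \<Longrightarrow> c i \<in> {1..5} \<and> d i \<in> {1..5} \<and> c i \<noteq> d i"
    and \<beta>: "\<And>i. i \<in> {1..r} \<Longrightarrow> biadditive (\<beta> i)"
    and \<tau>: "\<And>i. i \<in> {1..r} \<Longrightarrow> multi ({1..5} - {c i, d i}) (\<tau> i)"
  obtains t m L where "m \<le> 10 * 4 ^ r" "product_sum m t" "multi {1..5} t"
    "\<And>x a b. (a, b) \<in> {(1, 2), (1, 3), (2, 3)} \<Longrightarrow> t (x \<circ> transpose a b) = t x"
    "finite L" "card L \<le> 13000 * 16 ^ r" "\<And>\<phi>. \<phi> \<in> L \<Longrightarrow> additive_form \<phi>"
    "\<And>x. (\<And>\<phi> j. \<phi> \<in> L \<Longrightarrow> \<phi> (x j) = 0) \<Longrightarrow>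
      f (x \<circ> transpose 3 4) + t (x \<circ> transpose 3 4) = f x + t x"
proof -
  \<comment> \<open>The reversed forms make V closed under exchange of arguments; at most 2r
    generators give at most 4^r members.\<close>
  define S where "S = \<beta> ` {1..r} \<union> (\<lambda>i. \<beta> i \<circ> prod.swap) ` {1..r}"
  define V where "V = bit_span S"
  define N where "N = (4::nat) ^ r"
  have finS: "finite S" by (simp add: S_def)
  have finV: "finite V" unfolding V_def by (rule finite_bit_span[OF finS])
  have zeroV: "(\<lambda>_. 0) \<in> V" unfolding V_def by (rule zero_in_bit_span)
  have addV: "(\<lambda>x. \<phi> x + \<psi> x) \<in> V" if "\<phi> \<in> V" "\<psi> \<in> V" for \<phi> \<psi>
    using add_in_bit_span[OF finS] that by (simp add: V_def)
  have cardV: "card V \<le> N"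
  proof -
    have "card S \<le> card (\<beta> ` {1..r}) + card ((\<lambda>i. \<beta> i \<circ> prod.swap) ` {1..r})"
      unfolding S_def by (rule card_Un_le)
    also have "\<dots> \<le> r + r"
      using card_image_le[of "{1..r}" \<beta>] card_image_le[of "{1..r}" "\<lambda>i. \<beta> i \<circ> prod.swap"] by simp
    finally have "(2::nat) ^ card S \<le> 2 ^ (2 * r)" by (intro power_increasing) auto
    then show ?thesis
      using card_bit_span[OF finS] by (simp add: V_def N_def power_mult)
  qed
  have \<beta>V: "\<beta> i \<in> V" if "i \<in> {1..r}" for i
    unfolding V_def using that by (intro base_in_bit_span) (auto simp: S_def)
  have biV: "biadditive \<phi>" if "\<phi> \<in> V" for \<phi>
    using finS that[unfolded V_def]
  proof (induction rule: bit_span_induct)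
    case (base b)
    then show ?case using \<beta> biadditive_swap unfolding S_def by blast
  qed (auto intro: biadditive_zero biadditive_add)
  have swapV: "\<phi> \<circ> prod.swap \<in> V" if "\<phi> \<in> V" for \<phi>
    using finS that[unfolded V_def]
  proof (induction rule: bit_span_induct)
    case zero
    then show ?case using zeroV by (simp add: comp_def)
  next
    case (base b)
    then have "b \<circ> prod.swap \<in> S" by (auto simp: S_def comp_assoc)
    then show ?case unfolding V_def by (rule base_in_bit_span)
  next
    case (add \<phi> \<psi>)
    then show ?case using addV[of "\<phi> \<circ> prod.swap" "\<psi> \<circ> prod.swap"] by (simp add: comp_def)
  qed
  define W where "W = {\<phi> \<in> V. \<phi> \<circ> prod.swap = \<phi>}"
  have W: "finite W" "(\<lambda>_. 0) \<in> W" "\<And>\<phi> \<psi>. \<phi> \<in> W \<Longrightarrow> \<psi> \<in> W \<Longrightarrow> (\<lambda>x. \<phi> x + \<psi> x) \<in> W"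
    using finV zeroV addV by (auto simp: W_def fun_eq_iff)
  obtain k g p where k: "k \<le> card W" and gW: "\<And>i. i < k \<Longrightarrow> g i \<in> W"
    and g_dual: "\<And>i j. i < k \<Longrightarrow> j < k \<Longrightarrow> g i (p j) = of_bool (i = j)"
    and g_expand: "\<And>\<phi> y. \<phi> \<in> W \<Longrightarrow> \<phi> y = (\<Sum>i<k. \<phi> (p i) * g i y)"
    by (rule interpolation[OF W, of UNIV]) auto
  have kN: "k \<le> N"
    using k cardV card_mono[OF finV, of W] by (auto simp: W_def)
  have gV: "g i \<in> V" and g_sym: "g i (v, u) = g i (u, v)" if "i < k" for i u v
  proof -
    show "g i \<in> V" using gW[OF that] by (simp add: W_def)
    have "g i \<circ> prod.swap = g i" using gW[OF that] by (simp add: W_def)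
    from fun_cong[OF this, of "(u, v)"] show "g i (v, u) = g i (u, v)" by simp
  qed
  define X where "X = p ` {..<k} \<union> prod.swap ` p ` {..<k}"
  have finX: "finite X" by (simp add: X_def)
  have cardX: "card X \<le> 2 * N"
  proof -
    have "card (p ` {..<k}) \<le> k" using card_image_le[of "{..<k}" p] by simp
    moreover from this have "card (prod.swap ` p ` {..<k}) \<le> k"
      using card_image_le[of "p ` {..<k}" prod.swap] by simp
    ultimately show ?thesis
      using card_Un_le[of "p ` {..<k}" "prod.swap ` p ` {..<k}"] kN unfolding X_def by linarith
  qed
  \<comment> \<open>In characteristic two this takes two rounds: \<phi> plus its reversal is
    symmetric and vanishes at the \<open>p i\<close>, hence is zero; so \<phi> itself is symmetric,
    and the same argument applies to it.\<close>
  have sep: "\<phi> = (\<lambda>_. 0)" if \<phi>: "\<phi> \<in> V" and van: "\<And>y. y \<in> X \<Longrightarrow> \<phi> y = 0" for \<phi>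
  proof -
    have p0: "\<phi> (p i) = 0" "\<phi> (prod.swap (p i)) = 0" if "i < k" for i
      using van[of "p i"] van[of "prod.swap (p i)"] that by (auto simp: X_def)
    define \<sigma> where "\<sigma> y = \<phi> y + \<phi> (prod.swap y)" for y
    have "\<sigma> \<in> V" using addV[OF \<phi> swapV[OF \<phi>]] by (simp add: \<sigma>_def[abs_def] comp_def)
    then have "\<sigma> \<in> W" by (auto simp: W_def \<sigma>_def fun_eq_iff add.commute)
    then have "\<sigma> y = 0" for y using g_expand[of \<sigma> y] p0 by (simp add: \<sigma>_def[of "p _"])
    then have "\<phi> (prod.swap y) = \<phi> y" for y
      unfolding \<sigma>_def by (metis add.right_neutral bit_add_left_self)
    then have "\<phi> \<in> W" using \<phi> by (auto simp: W_def fun_eq_iff simp del: swap_simp)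
    then show ?thesis using g_expand[of \<phi>] p0 by (auto simp: fun_eq_iff)
  qed
  obtain l h q where l: "l \<le> card V" and hV: "\<And>j. j < l \<Longrightarrow> h j \<in> V" and qX: "\<And>j. j < l \<Longrightarrow> q j \<in> X"
    and h_dual: "\<And>i j. i < l \<Longrightarrow> j < l \<Longrightarrow> h i (q j) = of_bool (i = j)"
    and h_expand: "\<And>\<phi> y. \<phi> \<in> V \<Longrightarrow> \<phi> y = (\<Sum>j<l. \<phi> (q j) * h j y)"
    by (rule interpolation[OF finV zeroV addV sep]) auto
  define I where "I = {1..5::nat}"
  \<comment> \<open>First components suffice because X is closed under reversal. \<open>L1\<close>
    serves \<open>orth\<close>, \<open>L2\<close> the degeneracy of the factors \<tau>, and
    \<open>L3\<close> serves \<open>f_kill\<close>.\<close>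
  define L1 where "L1 = (\<lambda>(\<phi>, u) w. \<phi> (u, w)) ` (V \<times> fst ` X) \<union> (\<lambda>(\<phi>, u) w. \<phi> (w, u)) ` (V \<times> fst ` X)"
  define L2 where "L2 = (\<lambda>(i, (u, v), a, b, e) w. \<tau> i ((\<lambda>_. 0)(a := u, b := v, e := w))) `
      ({1..r} \<times> X \<times> I \<times> I \<times> I)"
  define L3 where "L3 = (\<lambda>((u, v), (u', v'), a, b, a', b', e) w.
      f ((\<lambda>_. 0)(a := u, b := v, a' := u', b' := v', e := w))) ` (X \<times> X \<times> I \<times> I \<times> I \<times> I \<times> I)"
  \<comment> \<open>The index tuples range freely, so \<open>L2\<close> may contain nonzero
    constants, for instance when e is \<open>c i\<close> or \<open>d i\<close>; the condition
    discards them.\<close>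
  define L where "L = {\<phi> \<in> L1 \<union> L2 \<union> L3. additive_form \<phi>}"
  have fin: "finite L1" "finite L2" "finite L3"
    using finV finX by (simp_all add: L1_def L2_def L3_def I_def)
  have cardL: "card L \<le> 13000 * 16 ^ r"
  \<comment> \<open>The three sets contribute 4, 2 * 125 and 4 * 3125 times N^2, in total 12754 N^2;
    the powers of 5 count the choices of indices.\<close>
  proof -
    have fX: "card (fst ` X) \<le> 2 * N" using card_image_le[OF finX, of fst] cardX by simp
    have VX: "card (V \<times> fst ` X) \<le> N * (2 * N)"
      using cardV fX by (simp add: card_cartesian_product mult_mono)
    have 1: "card L1 \<le> N * (2 * N) + N * (2 * N)"
    proof -
      have fVX: "finite (V \<times> fst ` X)" using finV finX by simp
      show ?thesis
        unfolding L1_def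
        by (rule order_trans[OF card_Un_le add_mono]; rule order_trans[OF card_image_le[OF fVX] VX])
    qed
    have "card L2 \<le> card ({1..r} \<times> X \<times> I \<times> I \<times> I)"
      unfolding L2_def using finX by (intro card_image_le) (simp add: I_def)
    also have "\<dots> = r * (card X * 125)" by (simp add: card_cartesian_product I_def)
    also have "\<dots> \<le> N * (2 * N * 125)"
    proof -
      have "r \<le> N" unfolding N_def by (rule less_imp_le) (rule less_exp[THEN less_le_trans], simp add: power_mono)
      then show ?thesis using cardX by (intro mult_mono) auto
    qed
    finally have 2: "card L2 \<le> N * (2 * N * 125)" .
    have "card L3 \<le> card (X \<times> X \<times> I \<times> I \<times> I \<times> I \<times> I)"
      unfolding L3_def using finX by (intro card_image_le) (simp add: I_def)
    also have "\<dots> = card X * (card X * 3125)" by (simp add: card_cartesian_product I_def)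
    also have "\<dots> \<le> 2 * N * (2 * N * 3125)" using cardX by (intro mult_mono) auto
    finally have 3: "card L3 \<le> 2 * N * (2 * N * 3125)" .
    have "card L \<le> card (L1 \<union> L2 \<union> L3)" unfolding L_def using fin by (intro card_mono) auto
    also have "\<dots> \<le> card L1 + card L2 + card L3"
      using card_Un_le[of "L1 \<union> L2" L3] card_Un_le[of L1 L2] by linarith
    also have "\<dots> \<le> 13000 * (N * N)" using 1 2 3 by simp
    also have "N * N = 16 ^ r" by (simp add: N_def flip: power_mult_distrib)
    finally show ?thesis .
  qed
  define U where "U = {w. \<forall>\<phi>\<in>L. \<phi> w = 0}"
  have U: "\<phi> w = 0" if "w \<in> U" "\<phi> \<in> L1 \<union> L2 \<union> L3" "additive_form \<phi>" for \<phi> w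
    using that by (auto simp: U_def L_def)
  have X_swap: "(v, u) \<in> X" if "(u, v) \<in> X" for u v
  proof -
    have "prod.swap ` X = X" by (auto simp: X_def image_Un image_image)
    then show ?thesis using that by (metis image_eqI swap_simp)
  qed
  have half: "\<phi> (u, w) = 0 \<and> \<phi> (w, u) = 0" if "\<phi> \<in> V" "(u, v) \<in> X" "w \<in> U" for \<phi> u v w
  proof -
    have "u \<in> fst ` X" using that(2) by force
    then have "(\<lambda>w. \<phi> (u, w)) \<in> L1" "(\<lambda>w. \<phi> (w, u)) \<in> L1"
      using that(1) unfolding L1_def by (auto intro!: image_eqI[of _ _ "(\<phi>, u)"])
    moreover have "additive_form (\<lambda>w. \<phi> (u, w))" "additive_form (\<lambda>w. \<phi> (w, u))"
      using biV[OF that(1)] by (auto simp: biadditive_def)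
    ultimately show ?thesis using U[OF that(3)] by auto
  qed
  interpret dual_system V X U l h q
    by unfold_locales (use swapV qX h_expand half X_swap in blast)+
  have \<tau>_kill: "\<tau> i (x(a := u, b := v)) = 0"
    if i: "i \<in> {1..r}" and ab: "a \<in> {1..5} - {c i, d i}" "b \<in> {1..5} - {c i, d i}" "a \<noteq> b"
      and uv: "(u, v) \<in> X" and x: "range x \<subseteq> U" for i a b u v x
  proof -
    \<comment> \<open>Besides a and b, \<open>\<tau> i\<close> depends on one coordinate e only, so
      after the substitution it is a linear form in \<open>x e\<close>, listed in
      \<open>L2\<close>.\<close>
    obtain e where e: "e \<in> {1..5}" "e \<notin> {a, b, c i, d i}" "{1..5} \<subseteq> {a, b, c i, d i, e}"
      using cd[OF i] ab by (elim fifth_index[of a b "c i" "d i", rotated 2]) auto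
    let ?\<phi> = "\<lambda>w. \<tau> i ((\<lambda>_. 0)(a := u, b := v, e := w))"
    have "?\<phi> \<in> L2"
      unfolding L2_def using i ab uv e(1)
      by (intro image_eqI[of _ _ "(i, (u, v), a, b, e)"]) (auto simp: I_def)
    moreover have "additive_form ?\<phi>"
      using e by (intro multi_additive[OF \<tau>[OF i]]) auto
    ultimately have "?\<phi> (x e) = 0" using U[of "x e" ?\<phi>] x by auto
    moreover have "\<tau> i (x(a := u, b := v)) = ?\<phi> (x e)"
      using e by (intro multi_cong[OF \<tau>[OF i]]) auto
    ultimately show ?thesis by simp
  qed
  have f_kill: "f (x(a := u, b := v, a' := u', b' := v')) = 0"
    if sub: "{a, b, a', b'} \<subseteq> {1..5}" and dist: "distinct [a, b, a', b']"
      and uv: "(u, v) \<in> X" "(u', v') \<in> X" and x: "range x \<subseteq> U" for a b a' b' u v u' v' x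
  proof -
    obtain e where e: "e \<in> {1..5}" "e \<notin> {a, b, a', b'}" "{1..5} \<subseteq> {a, b, a', b', e}"
      using fifth_index[OF sub dist] by blast
    let ?\<phi> = "\<lambda>w. f ((\<lambda>_. 0)(a := u, b := v, a' := u', b' := v', e := w))"
    have "?\<phi> \<in> L3"
      unfolding L3_def using sub uv e(1)
      by (intro image_eqI[of _ _ "((u, v), (u', v'), a, b, a', b', e)"]) (auto simp: I_def)
    moreover have "additive_form ?\<phi>"
      using e by (intro multi_additive[OF f_multi]) auto
    ultimately have "?\<phi> (x e) = 0" using U[of "x e" ?\<phi>] x by auto
    moreover have "f (x(a := u, b := v, a' := u', b' := v')) = ?\<phi> (x e)"
      using e dist by (intro multi_cong[OF f_multi]) auto
    ultimately show ?thesis by simp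
  qed
  have elem: "elementary V X U (\<lambda>x. \<beta> i (x (c i), x (d i)) * \<tau> i x)" if i: "i \<in> {1..r}" for i
    unfolding elementary_def
    using cd[OF i] \<beta>V[OF i] \<tau>[OF i] \<tau>_kill[OF i]
    by (intro exI[of _ "c i"] exI[of _ "d i"] exI[of _ "\<beta> i"] exI[of _ "\<tau> i"]) auto
  have tame: "tame (\<lambda>x. f x + f (x \<circ> transpose 3 4))"
    unfolding defect by (intro tame_sum elementary_tame elem)
  interpret symmetrization V X U l h q k g p f
    by unfold_locales (fact biV hV h_dual gV g_dual g_sym X_def f_multi f_sym f_kill tame)+
  have "3 * k + 7 * l \<le> 10 * 4 ^ r" using kN l cardV by (simp add: N_def)
  moreover have "f (x \<circ> transpose 3 4) + correction (x \<circ> transpose 3 4) = f x + correction x"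
    if "\<And>\<phi> j. \<phi> \<in> L \<Longrightarrow> \<phi> (x j) = 0" for x
    using that by (intro corrected_invariant) (auto simp: U_def)
  moreover have "finite L" using fin by (simp add: L_def)
  moreover have "additive_form \<phi>" if "\<phi> \<in> L" for \<phi> using that by (simp add: L_def)
  ultimately show ?thesis
    using that[OF _ correction_product_sum correction_multi correction_sym _ cardL] by blast
qed

section \<open>Reduction to products of bilinear and trilinear forms, and the two
  projections\<close>

lemma biadditive_of_multi:
  assumes B: "multi {c, d} B" and cd: "c \<noteq> d"
  shows "biadditive (\<lambda>(u, v). B ((\<lambda>_. 0)(c := u, d := v)))" "B x = B ((\<lambda>_. 0)(c := x c, d := x d))"
proof -
  have "additive_form (\<lambda>u. B ((\<lambda>_. 0)(c := u, d := w)))" for w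
    using multi_additive[OF B, of c "(\<lambda>_. 0)(d := w)"] cd by (simp add: fun_upd_twist[of c d])
  then show "biadditive (\<lambda>(u, v). B ((\<lambda>_. 0)(c := u, d := v)))"
    using multi_additive[OF B, of d] by (simp add: biadditive_def)
  show "B x = B ((\<lambda>_. 0)(c := x c, d := x d))"
    by (rule multi_cong[OF B]) (use cd in auto)
qed

lemma additive_of_multi:
  assumes B: "multi {a} B"
  shows "additive_form (\<lambda>w. B (\<lambda>_. w))" "B x = B (\<lambda>_. x a)"
proof -
  have "B (\<lambda>_. w) = B ((\<lambda>_. 0)(a := w))" for w
    by (rule multi_cong[OF B]) auto
  then show "additive_form (\<lambda>w. B (\<lambda>_. w))"
    using multi_additive[OF B, of a "\<lambda>_. 0"] by simp
  show "B x = B (\<lambda>_. x a)" by (rule multi_cong[OF B]) auto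
qed

text \<open>The three terms of the bound are the cost of the projection that removes the factors in
  one variable from the defect, of the correction, and of the projection onto the kernel of the
  forms in L.\<close>

lemma symmetric_approximation:
  fixes f :: "(nat \<Rightarrow> 'a::ab_group_add) \<Rightarrow> bit" and r :: nat
  assumes char2: "\<And>e::'a. e + e = 0"
    and f_multi: "multi {1..5} f"
    and f_sym: "\<And>x a b. (a, b) \<in> {(1, 2), (1, 3), (2, 3)} \<Longrightarrow> f (x \<circ> transpose a b) = f x"
    and defect: "\<And>x. f x + f (x \<circ> transpose 3 4) = (\<Sum>i = 1..r. \<beta> i x * \<gamma> i x)"
    and J: "\<And>i. i \<in> {1..r} \<Longrightarrow> J i \<noteq> {} \<and> J i \<subset> {1..5}"
    and \<beta>: "\<And>i. i \<in> {1..r} \<Longrightarrow> multi (J i) (\<beta> i)"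
    and \<gamma>: "\<And>i. i \<in> {1..r} \<Longrightarrow> multi ({1..5} - J i) (\<gamma> i)"
  obtains H m where "multi {1..5} H"
    "\<And>x a b. (a, b) \<in> {(1, 2), (1, 3), (2, 3), (3, 4)} \<Longrightarrow> H (x \<circ> transpose a b) = H x"
    "product_sum m (\<lambda>x. f x + H x)" "m \<le> 5 * 2 ^ r + 10 * 4 ^ r + 5 * 2 ^ (13000 * 16 ^ r)"
proof -
  \<comment> \<open>If the split is 1 + 4 or 4 + 1, this is the factor in one variable, evaluated at
    a constant tuple so that its index need not be named. For the other splits the value is
    arbitrary; \<open>L0\<close> keeps it only if it is additive, which does no harm.\<close>
  define \<phi> where "\<phi> i w = (if card (J i) = 1 then \<beta> i else \<gamma> i) (\<lambda>_. w)" for i w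
  define L0 where "L0 = {l \<in> \<phi> ` {1..r}. additive_form l}"
  have "card L0 \<le> card (\<phi> ` {1..r})" unfolding L0_def by (intro card_mono) auto
  also have "\<dots> \<le> r" using card_image_le[of "{1..r}" \<phi>] by simp
  finally have L0: "card L0 \<le> r" .
  obtain k0 p0 where k0: "k0 \<le> 2 ^ card L0" and p0_add: "\<And>u v. p0 (u + v) = p0 u + p0 v"
    and p0_kill: "\<And>l u. l \<in> L0 \<Longrightarrow> l (p0 u) = 0"
    and p0_rank: "\<And>F. multi {1..5} F \<Longrightarrow> product_sum (5 * k0) (\<lambda>x. F x + F (\<lambda>j. p0 (x j)))"
    by (rule annihilating_projection[OF char2, of L0]) (auto simp: L0_def)
  define f0 where "f0 x = f (\<lambda>j. p0 (x j))" for x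
  have f0_multi: "multi {1..5} f0"
    unfolding f0_def using multi_map[OF f_multi, of "\<lambda>_. p0"] p0_add by simp
  have f0_perm: "f0 (x \<circ> \<pi>) = f ((\<lambda>j. p0 (x j)) \<circ> \<pi>)" for x \<pi>
    by (simp add: f0_def comp_def)
  have f0_sym: "f0 (x \<circ> transpose a b) = f0 x" if "(a, b) \<in> {(1, 2), (1, 3), (2, 3)}" for x a b
    using f_sym[OF that] by (simp add: f0_perm) (simp add: f0_def)
  define B where "B i x = \<beta> i (\<lambda>j. p0 (x j))" for i x
  define C where "C i x = \<gamma> i (\<lambda>j. p0 (x j))" for i x
  have f0_defect: "f0 x + f0 (x \<circ> transpose 3 4) = (\<Sum>i = 1..r. B i x * C i x)" for x
    using defect[of "\<lambda>j. p0 (x j)"] by (simp add: f0_perm B_def C_def) (simp add: f0_def)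
  have B: "multi (J i) (B i)" if "i \<in> {1..r}" for i
    unfolding B_def using multi_map[OF \<beta>[OF that], of "\<lambda>_. p0"] p0_add by simp
  have C: "multi ({1..5} - J i) (C i)" if "i \<in> {1..r}" for i
    unfolding C_def using multi_map[OF \<gamma>[OF that], of "\<lambda>_. p0"] p0_add by simp
  \<comment> \<open>A common shape for all r products: bilinear factor first. Splits 3 + 2 are
    exchanged.\<close>
  define Q where "Q D E c d b t \<longleftrightarrow> (c \<in> {1..5} \<and> d \<in> {1..5} \<and> c \<noteq> d) \<and> biadditive b \<and>
      multi ({1..5} - {c, d}) t \<and> (\<forall>x. D x * E x = b (x c, x d) * t x)"
    for D E t :: "(nat \<Rightarrow> 'a) \<Rightarrow> bit" and c d b
  have "\<exists>c d b t. Q (B i) (C i) c d b t" if i: "i \<in> {1..r}" for i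
  proof -
    have pair: "\<exists>c d b t. Q D E c d b t"
      if "multi K D" "multi ({1..5} - K) E" "card K = 2" "K \<subseteq> {1..5}" for K D E
    proof -
      obtain c d where K: "K = {c, d}" "c \<noteq> d" using \<open>card K = 2\<close> by (meson card_2_iff)
      note bi = biadditive_of_multi[OF that(1)[unfolded K(1)] K(2)]
      show ?thesis
        unfolding Q_def using K that(2,4) bi(1) bi(2)
        by (intro exI[of _ c] exI[of _ d] exI[of _ "\<lambda>(u, v). D ((\<lambda>_. 0)(c := u, d := v))"] exI[of _ E]) auto
    qed
    \<comment> \<open>A product killed by the first projection is recorded as a zero product at the
      arbitrary pair (1, 2).\<close>
    have triv: "\<exists>c d b t. Q D E c d b t" if "\<And>x. D x * E x = 0" for D E
      unfolding Q_def using that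
      by (intro exI[of _ 1] exI[of _ 2] exI[of _ "\<lambda>_. 0"]) (auto simp: biadditive_zero intro: multi_zero)
    have fin: "finite (J i)" using J[OF i] finite_subset by blast
    have "card (J i) < 5" using psubset_card_mono[of "{1..5}" "J i"] J[OF i] by simp
    moreover have "card (J i) \<noteq> 0" using J[OF i] fin by simp
    ultimately consider "card (J i) = 1" | "card (J i) = 2" | "card (J i) = 3" | "card (J i) = 4" by linarith
    then show ?thesis
    proof cases
      case 1
      then obtain a where a: "J i = {a}" by (rule card_1_singletonE)
      note m = \<beta>[OF i, unfolded a]
      have "\<phi> i = (\<lambda>w. \<beta> i (\<lambda>_. w))" using 1 by (simp add: \<phi>_def[abs_def])
      then have "additive_form (\<phi> i)" using additive_of_multi(1)[OF m] by simp
      then have "\<phi> i \<in> L0" unfolding L0_def using i by blast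
      then have "B i x = 0" for x
        using p0_kill[of "\<phi> i"] additive_of_multi(2)[OF m, of "\<lambda>j. p0 (x j)"] \<open>\<phi> i = _\<close> by (simp add: B_def)
      then show ?thesis using triv by simp
    next
      case 2
      then show ?thesis using pair[OF B[OF i] C[OF i]] J[OF i] by blast
    next
      case 3
      then have "card ({1..5} - J i) = 2" using card_Diff_subset[OF fin, of "{1..5}"] J[OF i] by auto
      moreover have "{1..5} - ({1..5} - J i) = J i" using J[OF i] by blast
      ultimately show ?thesis
        using pair[OF C[OF i], of "B i"] B[OF i] unfolding Q_def by (simp add: mult.commute)
    next
      case 4
      then have "card ({1..5} - J i) = 1" using card_Diff_subset[OF fin, of "{1..5}"] J[OF i] by auto
      then obtain a where a: "{1..5} - J i = {a}" by (rule card_1_singletonE)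
      note m = \<gamma>[OF i, unfolded a]
      have "\<phi> i = (\<lambda>w. \<gamma> i (\<lambda>_. w))" using 4 by (simp add: \<phi>_def[abs_def])
      then have "additive_form (\<phi> i)" using additive_of_multi(1)[OF m] by simp
      then have "\<phi> i \<in> L0" unfolding L0_def using i by blast
      then have "C i x = 0" for x
        using p0_kill[of "\<phi> i"] additive_of_multi(2)[OF m, of "\<lambda>j. p0 (x j)"] \<open>\<phi> i = _\<close> by (simp add: C_def)
      then show ?thesis using triv by simp
    qed
  qed
  then obtain c d b t where Q: "\<And>i. i \<in> {1..r} \<Longrightarrow> Q (B i) (C i) (c i) (d i) (b i) (t i)"
    by metis
  have parts: "c i \<in> {1..5} \<and> d i \<in> {1..5} \<and> c i \<noteq> d i" "biadditive (b i)"
    "multi ({1..5} - {c i, d i}) (t i)" and BC: "B i x * C i x = b i (x (c i), x (d i)) * t i x"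
    if "i \<in> {1..r}" for i x
    using Q[OF that] unfolding Q_def by blast+
  have sum: "f0 x + f0 (x \<circ> transpose 3 4) = (\<Sum>i = 1..r. b i (x (c i), x (d i)) * t i x)" for x
    unfolding f0_defect using BC by (intro sum.cong) auto
  obtain t m L where m: "m \<le> 10 * 4 ^ r" "product_sum m t" and t_multi: "multi {1..5} t"
    and t_sym: "\<And>x a b. (a, b) \<in> {(1, 2), (1, 3), (2, 3)} \<Longrightarrow> t (x \<circ> transpose a b) = t x"
    and L: "finite L" "card L \<le> 13000 * 16 ^ r" "\<And>\<phi>. \<phi> \<in> L \<Longrightarrow> additive_form \<phi>"
    and inv: "\<And>x. (\<And>\<phi> j. \<phi> \<in> L \<Longrightarrow> \<phi> (x j) = 0) \<Longrightarrow>
      f0 (x \<circ> transpose 3 4) + t (x \<circ> transpose 3 4) = f0 x + t x"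
    by (rule low_rank_correction[where f = f0 and \<beta> = b and c = c and d = d and \<tau> = t and r = r,
          OF f0_multi f0_sym sum parts]) blast+
  obtain k1 p1 where k1: "k1 \<le> 2 ^ card L" and p1_add: "\<And>u v. p1 (u + v) = p1 u + p1 v"
    and p1_kill: "\<And>l u. l \<in> L \<Longrightarrow> l (p1 u) = 0"
    and p1_rank: "\<And>F. multi {1..5} F \<Longrightarrow> product_sum (5 * k1) (\<lambda>x. F x + F (\<lambda>j. p1 (x j)))"
    by (rule annihilating_projection[OF char2 L(1,3)]) blast+
  define F where "F x = f0 x + t x" for x
  define H where "H x = F (\<lambda>j. p1 (x j))" for x
  have F_multi: "multi {1..5} F" unfolding F_def by (intro multi_add f0_multi t_multi)
  have H_multi: "multi {1..5} H"
    unfolding H_def using multi_map[OF F_multi, of "\<lambda>_. p1"] p1_add by simp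
  have H_perm: "H (x \<circ> \<pi>) = F ((\<lambda>j. p1 (x j)) \<circ> \<pi>)" for x \<pi>
    by (simp add: H_def comp_def)
  have H_sym: "H (x \<circ> transpose a b) = H x" if "(a, b) \<in> {(1, 2), (1, 3), (2, 3), (3, 4)}" for x a b
  proof (cases "(a, b) = (3, 4)")
    case True
    then show ?thesis
      using inv[of "\<lambda>j. p1 (x j)"] p1_kill by (simp add: H_perm) (simp add: H_def F_def)
  next
    case False
    then have "(a, b) \<in> {(1, 2), (1, 3), (2, 3)}" using that by auto
    then show ?thesis
      using f0_sym[of a b] t_sym[of a b] by (simp only: H_perm) (simp only: H_def F_def)
  qed
  \<comment> \<open>Since F is f0 + t, the terms f0 and t cancel in pairs and f + H remains.\<close>
  have "product_sum (5 * k0 + (5 * k1 + m)) (\<lambda>x. (f x + f0 x) + ((F x + H x) + t x))"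
    using product_sum_add[OF p0_rank[OF f_multi] product_sum_add[OF p1_rank[OF F_multi] m(2)]]
    by (simp only: f0_def H_def)
  moreover have "(f x + f0 x) + ((F x + H x) + t x) = f x + H x" for x
    by (simp add: F_def ac_simps)
  ultimately have "product_sum (5 * k0 + (5 * k1 + m)) (\<lambda>x. f x + H x)" by simp
  moreover have "5 * k0 + (5 * k1 + m) \<le> 5 * 2 ^ r + 10 * 4 ^ r + 5 * 2 ^ (13000 * 16 ^ r)"
  proof -
    have "k0 \<le> 2 ^ r" by (rule order_trans[OF k0 power_increasing[OF L0]]) simp
    moreover have "k1 \<le> 2 ^ (13000 * 16 ^ r)" by (rule order_trans[OF k1 power_increasing[OF L(2)]]) simp
    ultimately show ?thesis using m(1) by linarith
  qed
  ultimately show ?thesis using that H_multi H_sym by blast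
qed

subsection \<open>Forms on vectors of fixed length\<close>

text \<open>Replaces the carrier set of vectors of length n by functions that form an abelian group
  as a whole type.\<close>

definition pad :: "nat \<Rightarrow> bit vec \<Rightarrow> nat \<Rightarrow> bit" where
  "pad n v = (\<lambda>i. if i < n then v $ i else 0)"

definition pull :: "nat \<Rightarrow> nat set \<Rightarrow> ((nat \<Rightarrow> bit vec) \<Rightarrow> bit) \<Rightarrow> (nat \<Rightarrow> nat \<Rightarrow> bit) \<Rightarrow> bit" where
  "pull n I \<alpha> a = \<alpha> (\<lambda>j\<in>I. vec n (a j))"

definition push :: "nat \<Rightarrow> ((nat \<Rightarrow> nat \<Rightarrow> bit) \<Rightarrow> bit) \<Rightarrow> (nat \<Rightarrow> bit vec) \<Rightarrow> bit" where
  "push n F x = F (\<lambda>j. pad n (x j))"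

lemma pad_add: "u \<in> carrier_vec n \<Longrightarrow> v \<in> carrier_vec n \<Longrightarrow> pad n (u + v) = pad n u + pad n v"
  by (auto simp: pad_def fun_eq_iff)

lemma restrict_vec_tuples: "(\<lambda>j\<in>I. vec n (a j)) \<in> tuples n I"
  by (auto simp: tuples_def)

lemma restrict_vec_pad:
  assumes "x \<in> tuples n I"
  shows "(\<lambda>j\<in>I. vec n (pad n (x j))) = x"
proof
  fix j
  show "(\<lambda>j\<in>I. vec n (pad n (x j))) j = x j"
  proof (cases "j \<in> I")
    case True
    then have "x j \<in> carrier_vec n" using assms by (auto simp: tuples_def)
    then show ?thesis using True by (auto simp: pad_def)
  next
    case False
    then show ?thesis using assms by (auto simp: tuples_def PiE_def extensional_def)
  qed
qed

lemma push_pull: "x \<in> tuples n I \<Longrightarrow> push n (pull n I \<alpha>) x = \<alpha> x"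
  by (simp add: push_def pull_def restrict_vec_pad)

lemma multi_pull:
  assumes "multilinear_form n I \<alpha>"
  shows "multi I (pull n I \<alpha>)"
  unfolding multi_def
proof (intro conjI allI impI ballI)
  fix a b :: "nat \<Rightarrow> nat \<Rightarrow> bit" assume "\<forall>j\<in>I. a j = b j"
  then have "(\<lambda>j\<in>I. vec n (a j)) = (\<lambda>j\<in>I. vec n (b j))" by (intro restrict_ext) simp
  then show "pull n I \<alpha> a = pull n I \<alpha> b" by (simp add: pull_def)
next
  fix a :: "nat \<Rightarrow> nat \<Rightarrow> bit" and j assume j: "j \<in> I"
  have upd: "pull n I \<alpha> (a(j := u)) = \<alpha> ((\<lambda>j\<in>I. vec n (a j))(j := vec n u))" for u
    unfolding pull_def using j by (intro arg_cong[of _ _ \<alpha>]) (auto simp: fun_eq_iff)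
  have "vec n (u + v) = vec n u + vec n v" for u v :: "nat \<Rightarrow> bit"
    by auto
  then show "additive_form (\<lambda>u. pull n I \<alpha> (a(j := u)))"
    using assms j restrict_vec_tuples[where I=I and n=n and a=a]
    by (simp add: additive_form_def upd multilinear_form_def)
qed

lemma multilinear_push:
  assumes "multi I F"
  shows "multilinear_form n I (push n F)"
  unfolding multilinear_form_def
proof (intro ballI allI conjI)
  fix x :: "nat \<Rightarrow> bit vec" and j and u v :: "bit vec" and c :: bit
  assume j: "j \<in> I" and u: "u \<in> carrier_vec n" and v: "v \<in> carrier_vec n"
  have upd: "push n F (x(j := w)) = F ((\<lambda>i. pad n (x i))(j := pad n w))" for w
    unfolding push_def by (intro arg_cong[of _ _ F]) auto
  note add = multi_additive[OF assms j, of "\<lambda>i. pad n (x i)"]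
  show "push n F (x(j := u + v)) = push n F (x(j := u)) + push n F (x(j := v))"
    using additive_form_add[OF add] by (simp add: upd pad_add[OF u v])
  show "push n F (x(j := c \<cdot>\<^sub>v u)) = c * push n F (x(j := u))"
  proof (cases c)
    case zero
    have "pad n (0 \<cdot>\<^sub>v u) = 0" using u by (auto simp: pad_def)
    then show ?thesis using additive_form_zero[OF add] zero by (simp add: upd)
  next
    case one
    then show ?thesis by simp
  qed
qed

lemma push_restrict: "multi J F \<Longrightarrow> push n F (restrict x J) = push n F x"
  unfolding push_def by (erule multi_cong) simp

lemma decomposable_push:
  assumes "product_sum m F"
  shows "partition_decomposable n 5 (push n F) m"
  using assms
proof induction
  case zero
  then show ?case by (simp add: partition_decomposable_def push_def)
next
  case (step m F J \<beta> \<gamma>)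
  from step.IH obtain I B C where
    parts: "\<forall>i\<in>{1..m}. I i \<noteq> {} \<and> I i \<subset> {1..5} \<and> multilinear_form n (I i) (B i) \<and>
       multilinear_form n ({1..5} - I i) (C i)"
    and sum: "\<forall>x\<in>tuples n {1..5}.
       push n F x = (\<Sum>i = 1..m. B i (restrict x (I i)) * C i (restrict x ({1..5} - I i)))"
    unfolding partition_decomposable_def by blast
  let ?I = "I(Suc m := J)" and ?B = "B(Suc m := push n \<beta>)" and ?C = "C(Suc m := push n \<gamma>)"
  have "?I i \<noteq> {} \<and> ?I i \<subset> {1..5} \<and> multilinear_form n (?I i) (?B i) \<and>
      multilinear_form n ({1..5} - ?I i) (?C i)" if "i \<in> {1..Suc m}" for i
  proof (cases "i = Suc m")
    case True
    then show ?thesis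
      using step.hyps multilinear_push[OF step.hyps(4)] multilinear_push[OF step.hyps(5)] by simp
  next
    case False
    then show ?thesis using parts that by simp
  qed
  moreover have "push n (\<lambda>x. F x + \<beta> x * \<gamma> x) x =
      (\<Sum>i = 1..Suc m. ?B i (restrict x (?I i)) * ?C i (restrict x ({1..5} - ?I i)))"
    if "x \<in> tuples n {1..5}" for x
  proof -
    have "push n (\<lambda>x. F x + \<beta> x * \<gamma> x) x = push n F x + push n \<beta> x * push n \<gamma> x"
      by (simp add: push_def)
    also have "\<dots> = (\<Sum>i = 1..m. B i (restrict x (I i)) * C i (restrict x ({1..5} - I i))) +
        push n \<beta> (restrict x J) * push n \<gamma> (restrict x ({1..5} - J))"
      using sum that by (simp only: push_restrict[OF step.hyps(4)] push_restrict[OF step.hyps(5)])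
    also have "\<dots> = (\<Sum>i = 1..Suc m. ?B i (restrict x (?I i)) * ?C i (restrict x ({1..5} - ?I i)))"
      by simp
    finally show ?thesis .
  qed
  ultimately show ?case
    unfolding partition_decomposable_def by (intro exI[of _ ?I] exI[of _ ?B] exI[of _ ?C]) blast
qed

lemma decomposable_cong:
  assumes "\<And>x. x \<in> tuples n {1..k} \<Longrightarrow> \<alpha> x = \<beta> x"
  shows "partition_decomposable n k \<alpha> m \<longleftrightarrow> partition_decomposable n k \<beta> m"
  using assms by (simp add: partition_decomposable_def)

lemma bit_fun_add_self: "e + e = (0 :: nat \<Rightarrow> bit)"
  by (simp add: fun_eq_iff)

text \<open>A projection annihilating the first n coordinate functionals sends every point to one
  where the form vanishes, so the change it causes is the form itself and has bounded rank.\<close>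

lemma decomposable_exists:
  assumes "multilinear_form n {1..5} \<alpha>"
  shows "\<exists>m. partition_decomposable n 5 \<alpha> m"
proof -
  let ?F = "pull n {1..5} \<alpha>"
  have F: "multi {1..5} ?F" by (rule multi_pull[OF assms])
  define L where "L = (\<lambda>i (a :: nat \<Rightarrow> bit). a i) ` {..<n}"
  have L: "finite L" "\<And>l. l \<in> L \<Longrightarrow> additive_form l"
    by (auto simp: L_def additive_form_def)
  obtain k p where p: "\<And>l u. l \<in> L \<Longrightarrow> l (p u) = 0"
    and rank: "\<And>F. multi {1..5} F \<Longrightarrow> product_sum (5 * k) (\<lambda>x. F x + F (\<lambda>j. p (x j)))"
    by (rule annihilating_projection[OF bit_fun_add_self L]) blast+
  have "?F (\<lambda>j. p (x j)) = 0" for x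
  proof -
    have "p (x j) i = 0" if "i < n" for i j
      using p[of "\<lambda>a. a i" "x j"] that by (simp add: L_def)
    then have "vec n (p (x j)) = vec n 0" for j by (intro eq_vecI) auto
    then have "?F (\<lambda>j. p (x j)) = ?F (\<lambda>_. 0)" by (simp add: pull_def)
    also have "\<dots> = 0" by (rule multi_coord_zero[OF F, of 1]) auto
    finally show ?thesis .
  qed
  with rank[OF F] have "product_sum (5 * k) ?F" by simp
  from decomposable_push[OF this, of n] have "partition_decomposable n 5 \<alpha> (5 * k)"
    by (subst (asm) decomposable_cong[OF push_pull])
  then show ?thesis by blast
qed

section \<open>The numerical bound, generation of the permutations, and the final assembly\<close>

lemma rank_bound_mono:
  fixes m r s :: nat
  assumes "s \<le> 5 * 2 ^ m + 10 * 4 ^ m + 5 * 2 ^ (13000 * 16 ^ m)" "m \<le> r" "r > 0"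
  shows "real s \<le> exp (exp (20 * real r))"
proof -
  \<comment> \<open>T dominates all three exponents, so s is at most \<open>20 * 2 ^ T\<close>,
    below \<open>2 ^ (T + 5)\<close>.\<close>
  define T :: nat where "T = 13000 * 16 ^ r"
  have pow: "(2::nat) ^ m \<le> 2 ^ T" "(4::nat) ^ m \<le> 2 ^ T" "(2::nat) ^ (13000 * 16 ^ m) \<le> 2 ^ T"
  proof -
    have "m < 2 ^ m" by (rule less_exp)
    also have "(2::nat) ^ m \<le> 16 ^ m" by (rule power_mono) auto
    also have "(16::nat) ^ m \<le> 16 ^ r" using assms(2) by (intro power_increasing) auto
    finally have "2 * m \<le> T" by (simp add: T_def)
    then show "(2::nat) ^ m \<le> 2 ^ T" by (intro power_increasing) auto
    have "(4::nat) ^ m = 2 ^ (2 * m)" by (simp add: power_mult)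
    also have "\<dots> \<le> 2 ^ T" using \<open>2 * m \<le> T\<close> by (intro power_increasing) auto
    finally show "(4::nat) ^ m \<le> 2 ^ T" .
    have "13000 * (16::nat) ^ m \<le> T"
      unfolding T_def using assms(2) by (intro mult_left_mono power_increasing) auto
    then show "(2::nat) ^ (13000 * 16 ^ m) \<le> 2 ^ T" by (intro power_increasing) auto
  qed
  have "s \<le> 5 * 2 ^ T + 10 * 2 ^ T + 5 * 2 ^ T" using assms(1) pow by linarith
  also have "\<dots> \<le> 2 ^ (T + 5)" by (simp add: power_add)
  finally have "real s \<le> 2 ^ (T + 5)" by (metis of_nat_le_iff of_nat_numeral of_nat_power)
  also have two: "(2::real) ^ i \<le> exp (real i)" for i
  proof -
    have "(2::real) ^ i \<le> exp 1 ^ i" using exp_ge_add_one_self[of 1] by (intro power_mono) auto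
    then show ?thesis by (simp add: exp_of_nat_mult[of _ 1, symmetric] flip: exp_of_nat_mult)
  qed
  also have "exp (real (T + 5)) \<le> exp (exp (20 * real r))"
  proof -
    \<comment> \<open>The factor 20 comes from 65536 * 16 = 2^20; positivity of r lets the constant
      65536 be replaced by its r-th power.\<close>
    have "(16::nat) ^ 1 \<le> 16 ^ r" using assms(3) by (intro power_increasing) auto
    then have "T + 5 \<le> 65536 * 16 ^ r" by (simp add: T_def)
    also have "(65536::nat) \<le> 65536 ^ r" using assms(3) power_increasing[of 1 r "65536::nat"] by simp
    then have "65536 * 16 ^ r \<le> (65536::nat) ^ r * 16 ^ r" by simp
    also have "\<dots> = 2 ^ (20 * r)" by (simp add: power_mult flip: power_mult_distrib)
    finally have "real (T + 5) \<le> 2 ^ (20 * r)" by (metis of_nat_le_iff of_nat_numeral of_nat_power)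
    also have "\<dots> \<le> exp (20 * real r)" using two[of "20 * r"] by simp
    finally show ?thesis by simp
  qed
  finally show ?thesis .
qed

text \<open>The given transpositions generate: (a 4) with a in {1, 2} is the conjugate of (3 4) by
  (a 3), and transpositions generate all permutations.\<close>

lemma invariant_permutes4:
  assumes gen: "\<And>x a b. (a, b) \<in> {(1, 2), (1, 3), (2, 3), (3, 4)} \<Longrightarrow> H (x \<circ> transpose a b) = H x"
    and \<pi>: "\<pi> permutes {1..4::nat}"
  shows "H (x \<circ> \<pi>) = H x"
proof -
  have far: "H (x \<circ> transpose a 4) = H x" if "a \<in> {1, 2}" for a x
  proof -
    have "transpose a 4 = transpose a 3 \<circ> transpose 3 4 \<circ> transpose a (3::nat)"
      using that transpose_comp_triple[of a 4 3] by auto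
    then show ?thesis using gen[of a 3] gen[of 3 4] that by (auto simp flip: comp_assoc)
  qed
  have up: "H (x \<circ> transpose a b) = H x" if ab: "a \<in> {1..4}" "b \<in> {1..4}" "a < b" for a b x
  proof -
    have "a \<in> {1, 2, 3, 4}" "b \<in> {1, 2, 3, 4}" using ab by auto
    then consider "(a, b) \<in> {(1, 2), (1, 3), (2, 3), (3, 4)}" | "a \<in> {1, 2}" "b = 4"
      using ab(3) by auto
    then show ?thesis using gen far by cases blast+
  qed
  have all: "H (x \<circ> transpose a b) = H x" if "a \<in> {1..4}" "b \<in> {1..4}" "a \<noteq> b" for a b x
    using up[of a b x] up[of b a x] that by (cases "a < b") (auto simp: transpose_commute)
  have "\<forall>x. H (x \<circ> \<pi>) = H x"
    using \<pi> finite_atLeastAtMost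
  proof (induction rule: permutes_induct)
    case (swap a b \<rho>)
    have "H (x \<circ> (transpose a b \<circ> \<rho>)) = H x" for x
      using swap.IH all[OF swap.hyps(1-3), of x] by (simp only: comp_assoc[symmetric])
    then show ?case by blast
  qed auto
  then show ?thesis by blast
qed

theorem theorem9:
  shows "\<exists>A B :: real. A > 0 \<and> B > 0 \<and>
    (\<forall>(n :: nat) (r :: nat) (\<alpha> :: (nat \<Rightarrow> bit vec) \<Rightarrow> bit).
       r > 0 \<longrightarrow>
       multilinear_form n {1..5} \<alpha> \<longrightarrow>
       symmetric_in n 5 {1..3} \<alpha> \<longrightarrow>
       prank n 5 (\<lambda>x. \<alpha> x + permute_form \<alpha> (transpose 3 4) x) \<le> r \<longrightarrow>
       (\<exists>\<alpha>' :: (nat \<Rightarrow> bit vec) \<Rightarrow> bit.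
          multilinear_form n {1..5} \<alpha>' \<and>
          symmetric_in n 5 {1..4} \<alpha>' \<and>
          real (prank n 5 (\<lambda>x. \<alpha> x + \<alpha>' x)) \<le> exp (exp (A * real r powr B))))"
proof (rule exI[of _ 20], rule exI[of _ 1], intro conjI allI impI)
  fix n r :: nat and \<alpha> :: "(nat \<Rightarrow> bit vec) \<Rightarrow> bit"
  assume r: "r > 0" and \<alpha>: "multilinear_form n {1..5} \<alpha>" and sym: "symmetric_in n 5 {1..3} \<alpha>"
    and rank: "prank n 5 (\<lambda>x. \<alpha> x + permute_form \<alpha> (transpose 3 4) x) \<le> r"
  let ?D = "\<lambda>x. \<alpha> x + permute_form \<alpha> (transpose 3 4) x"
  define f where "f = pull n {1..5} \<alpha>"
  have f: "multi {1..5} f" unfolding f_def by (rule multi_pull[OF \<alpha>])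
  have perm: "f (a \<circ> transpose i j) = permute_form \<alpha> (transpose i j) (\<lambda>j\<in>{1..5}. vec n (a j))"
    if "i \<in> {1..5}" "j \<in> {1..5}" for a i j
  proof -
    have "transpose i j l \<in> {1..5} \<longleftrightarrow> l \<in> {1..5}" for l using that by (auto simp: transpose_def)
    then have "(\<lambda>l\<in>{1..5}. vec n (a (transpose i j l))) = (\<lambda>l\<in>{1..5}. vec n (a l)) \<circ> transpose i j"
      by (auto simp: fun_eq_iff restrict_def)
    then show ?thesis by (simp add: f_def pull_def permute_form_def)
  qed
  have f_sym: "f (a \<circ> transpose i j) = f a" if "(i, j) \<in> {(1, 2), (1, 3), (2, 3)}" for a i j
  proof -
    have ij: "i \<in> {1..3}" "j \<in> {1..3}" "i \<in> {1..5}" "j \<in> {1..5}" using that by auto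
    have "transpose i j permutes {1..3}" by (rule permutes_swap_id[OF ij(1,2)])
    then show ?thesis
      using sym restrict_vec_tuples[of n a "{1..5}"] unfolding perm[OF ij(3,4)] symmetric_in_def
      by (simp add: f_def pull_def)
  qed
  \<comment> \<open>The least number in \<open>prank\<close> is attained only once some
    decomposition of the defect is known to exist; hence the detour through its
    multilinearity.\<close>
  have "multi {1..5} (\<lambda>a. f a + f (a \<circ> transpose 3 4))"
    using multi_transpose[OF f, of 3 4] by (intro multi_add f) (simp add: transpose_image_eq)
  then have "multilinear_form n {1..5} (push n (\<lambda>a. f a + f (a \<circ> transpose 3 4)))"
    by (rule multilinear_push)
  then obtain m0 where "partition_decomposable n 5 (push n (\<lambda>a. f a + f (a \<circ> transpose 3 4))) m0"
    using decomposable_exists by blast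
  moreover have "push n (\<lambda>a. f a + f (a \<circ> transpose 3 4)) x = ?D x" if "x \<in> tuples n {1..5}" for x
    using perm[of 3 4 "\<lambda>j. pad n (x j)"] push_pull[OF that] restrict_vec_pad[OF that]
    by (simp add: push_def f_def)
  ultimately have "partition_decomposable n 5 ?D m0"
    by (subst (asm) decomposable_cong)
  then have "partition_decomposable n 5 ?D (prank n 5 ?D)"
    unfolding prank_def by (rule LeastI)
  moreover define m where "m = prank n 5 ?D"
  ultimately have "partition_decomposable n 5 ?D m" by simp
  then obtain J \<beta> \<gamma> where
    all: "\<forall>i\<in>{1..m}. J i \<noteq> {} \<and> J i \<subset> {1..5} \<and> multilinear_form n (J i) (\<beta> i) \<and>
      multilinear_form n ({1..5} - J i) (\<gamma> i)"
    and D: "\<forall>x\<in>tuples n {1..5}.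
      ?D x = (\<Sum>i = 1..m. \<beta> i (restrict x (J i)) * \<gamma> i (restrict x ({1..5} - J i)))"
    unfolding partition_decomposable_def by blast
  have m: "m \<le> r" using rank by (simp add: m_def)
  have parts: "J i \<noteq> {} \<and> J i \<subset> {1..5}" "multilinear_form n (J i) (\<beta> i)"
    "multilinear_form n ({1..5} - J i) (\<gamma> i)" if "i \<in> {1..m}" for i
    using all that by blast+
  have defect: "f a + f (a \<circ> transpose 3 4) =
      (\<Sum>i = 1..m. pull n (J i) (\<beta> i) a * pull n ({1..5} - J i) (\<gamma> i) a)" for a
  proof -
    have "f a + f (a \<circ> transpose 3 4) = ?D (\<lambda>j\<in>{1..5}. vec n (a j))"
      using perm[of 3 4 a] by (simp add: f_def pull_def)
    also have "\<dots> = (\<Sum>i = 1..m. pull n (J i) (\<beta> i) a * pull n ({1..5} - J i) (\<gamma> i) a)"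
      unfolding bspec[OF D restrict_vec_tuples]
    proof (rule sum.cong[OF refl])
      fix i assume "i \<in> {1..m}"
      then have "{1..5} \<inter> J i = J i" "{1..5} \<inter> ({1..5} - J i) = {1..5} - J i" using parts(1) by blast+
      then show "\<beta> i (restrict (\<lambda>j\<in>{1..5}. vec n (a j)) (J i)) *
          \<gamma> i (restrict (\<lambda>j\<in>{1..5}. vec n (a j)) ({1..5} - J i)) =
        pull n (J i) (\<beta> i) a * pull n ({1..5} - J i) (\<gamma> i) a"
        by (simp only: pull_def restrict_restrict)
    qed
    finally show ?thesis .
  qed
  obtain H s where H: "multi {1..5} H"
    and H_sym: "\<And>x a b. (a, b) \<in> {(1, 2), (1, 3), (2, 3), (3, 4)} \<Longrightarrow> H (x \<circ> transpose a b) = H x"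
    and s: "product_sum s (\<lambda>x. f x + H x)" "s \<le> 5 * 2 ^ m + 10 * 4 ^ m + 5 * 2 ^ (13000 * 16 ^ m)"
    by (rule symmetric_approximation[where f = f and r = m and J = J and
          \<beta> = "\<lambda>i. pull n (J i) (\<beta> i)" and \<gamma> = "\<lambda>i. pull n ({1..5} - J i) (\<gamma> i)",
          OF bit_fun_add_self f f_sym defect parts(1) multi_pull[OF parts(2)] multi_pull[OF parts(3)]]) blast+
  show "\<exists>\<alpha>'. multilinear_form n {1..5} \<alpha>' \<and> symmetric_in n 5 {1..4} \<alpha>' \<and>
      real (prank n 5 (\<lambda>x. \<alpha> x + \<alpha>' x)) \<le> exp (exp (20 * real r powr 1))"
  proof (intro exI[of _ "push n H"] conjI)
    show "multilinear_form n {1..5} (push n H)" by (rule multilinear_push[OF H])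
    show "symmetric_in n 5 {1..4} (push n H)"
      unfolding symmetric_in_def permute_form_def push_def
    proof (intro allI impI ballI)
      fix \<pi> :: "nat \<Rightarrow> nat" and x assume \<pi>: "\<pi> permutes {1..4}"
      have "H ((\<lambda>j. pad n (x j)) \<circ> \<pi>) = H (\<lambda>j. pad n (x j))"
        by (rule invariant_permutes4[where H = H, OF H_sym \<pi>])
      then show "H (\<lambda>j. pad n ((x \<circ> \<pi>) j)) = H (\<lambda>j. pad n (x j))" by (simp add: comp_def)
    qed
    have "partition_decomposable n 5 (push n (\<lambda>x. f x + H x)) s"
      by (rule decomposable_push[OF s(1)])
    moreover have "push n (\<lambda>x. f x + H x) x = \<alpha> x + push n H x" if "x \<in> tuples n {1..5}" for x
      using push_pull[OF that] by (simp add: push_def f_def)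
    ultimately have "partition_decomposable n 5 (\<lambda>x. \<alpha> x + push n H x) s"
      by (subst (asm) decomposable_cong)
    then have "prank n 5 (\<lambda>x. \<alpha> x + push n H x) \<le> s"
      unfolding prank_def by (rule Least_le)
    moreover have "real s \<le> exp (exp (20 * real r powr 1))"
      using rank_bound_mono[OF s(2) m r] by simp
    ultimately show "real (prank n 5 (\<lambda>x. \<alpha> x + push n H x)) \<le> exp (exp (20 * real r powr 1))"
      by linarith
  qed
qed auto

end
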